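(* Let $\kappa$ be a regular uncountable cardinal and $K$ a streamlined $\kappa$-tree. (1) If $\mathrm P(\kappa,2,{\sqsubseteq^*},1)$ holds, then there exists a normal and splitting streamlined $\kappa$-Souslin tree $T$ such that $V(T)\supseteq V^-(K)$. (2) If $\mathrm P(\kappa,\kappa,{\sqsubseteq},1)$ holds, then there exists a normal and splitting streamlined $\kappa$-Souslin tree $T$ such that $V(T)\supseteq V^-(K)\cap E^\kappa_{>\omega}$.
   Context: $H_\kappa$: sets of hereditary cardinality $<\kappa$. A streamlined $\kappa$-tree is a set $T\subseteq{}^{<\kappa}H_\kappa$ closed under restrictions with each $T_\alpha=T\cap{}^\alpha H_\kappa$ ($\alpha<\kappa$) nonempty of size $<\kappa$, viewed as the tree $(T,\subsetneq)$. Normal: for $\alpha<\beta<\kappa$, each node of level $\alpha$ has an extension in level $\beta$; splitting: each node has at least two immediate successors; $\kappa$-Souslin: no $\kappa$-branch and no antichain of size $\kappa$. An $\alpha$-branch: linearly ordered subset with set of heights $\alpha$; vanishing if no upper bound. $V^-(T)$: set of nonzero limit $\alpha<\kappa$ admitting a vanishing $\alpha$-branch; $V(T)$: set of nonzero limit $\alpha<\kappa$ such that every node of height $<\alpha$ lies on a vanishing $\alpha$-branch. $E^\kappa_{>\omega}=\{\alpha<\kappa\mid\mathrm{cf}(\alpha)>\omega\}$. For a set of ordinals $C$: $\mathrm{acc}(C)=\{\alpha\in C\mid\sup(C\cap\alpha)=\alpha>0\}$, $\mathrm{nacc}(C)=C\setminus\mathrm{acc}(C)$. $D\sqsubseteq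 C$ iff $D=C\cap\beta$ for some $\beta$; $D\sqsubseteq^*C$ iff $D\setminus\varepsilon\sqsubseteq C\setminus\varepsilon$ for some $\varepsilon<\sup(D)$. For a cardinal $\mu\le\kappa$ and relation $\mathcal R$, $\mathrm P(\kappa,\mu,\mathcal R,1)$ asserts that $\diamondsuit(\kappa)$ holds and there is a sequence $\langle\mathcal C_\alpha\mid\alpha<\kappa\rangle$ where each $\mathcal C_\alpha$ is a nonempty family of fewer than $\mu$ closed subsets $C$ of $\alpha$ with $\sup(C)=\sup(\alpha)$, such that for all $\alpha<\kappa$, $C\in\mathcal C_\alpha$ and $\bar\alpha\in\mathrm{acc}(C)$ there is $D\in\mathcal C_{\bar\alpha}$ with $D\mathrel{\mathcal R}C$, and for every cofinal $B\subseteq\kappa$ there are stationarily many $\alpha<\kappa$ with $\sup(\mathrm{nacc}(C)\cap B)=\alpha$ for all $C\in\mathcal C_\alpha$. *)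

theory Defs
  imports Main
begin

unbundle cardinal_syntax

text \<open>
  A cardinal \<open>\<kappa>\<close> is given by a well-ordered type \<open>'k\<close> whose order is a cardinal order:
  the ordinals below \<open>\<kappa>\<close> are the elements of \<open>'k\<close>, the ordinal \<open>\<alpha>\<close> as a set is
  \<open>{..<\<alpha>}\<close>, and \<open>\<kappa>\<close> as a set is \<open>UNIV\<close>.
\<close>

definition kappa :: "'k::wellorder rel" where
  "kappa = {(x, y). x \<le> y}"


subsection \<open>Sets of hereditary cardinality less than \<open>\<kappa>\<close>\<close>

text \<open>
  The type \<open>'k hset\<close> is the universe of all well-founded sets that hereditarily have at most
  \<open>\<kappa>\<close> elements, obtained from well-founded trees with branching indexed by \<open>'k\<close> modulo
  extensional equality. It contains every set of hereditary cardinality less than \<open>\<kappa>\<close>.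
\<close>

datatype 'k pset = PSet "'k \<rightharpoonup> 'k pset"

primrec pelems :: "'k pset \<Rightarrow> 'k pset set" where
  "pelems (PSet f) = ran f"

inductive ext_eq :: "'k pset \<Rightarrow> 'k pset \<Rightarrow> bool" where
  "\<forall>x\<in>pelems u. \<exists>y\<in>pelems v. ext_eq x y \<Longrightarrow>
   \<forall>y\<in>pelems v. \<exists>x\<in>pelems u. ext_eq x y \<Longrightarrow> ext_eq u v"

lemma pset_induct:
  assumes "\<And>u. (\<And>x. x \<in> pelems u \<Longrightarrow> P x) \<Longrightarrow> P u"
  shows "P u"
proof (induction u)
  case (PSet f)
  have "P x" if "x \<in> ran f" for x
  proof -
    from that obtain a where "f a = Some x" by (auto simp: ran_def)
    then show ?thesis using PSet.IH[of "f a" x] by (metis option.set_intros rangeI)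
  qed
  then show ?case using assms[of "PSet f"] by simp
qed

lemma ext_eq_refl: "ext_eq u u"
proof (induction u rule: pset_induct)
  case (1 u)
  show ?case by (rule ext_eq.intros) (use 1 in blast)+
qed

lemma ext_eqD:
  assumes "ext_eq u v"
  shows "x \<in> pelems u \<Longrightarrow> \<exists>y\<in>pelems v. ext_eq x y"
    and "y \<in> pelems v \<Longrightarrow> \<exists>x\<in>pelems u. ext_eq x y"
  using assms by (auto elim: ext_eq.cases)

lemma ext_eq_sym: "ext_eq u v \<Longrightarrow> ext_eq v u"
proof (induction rule: ext_eq.induct)
  case (1 u v)
  show ?case by (rule ext_eq.intros) (use 1 in blast)+
qed

lemma ext_eq_trans: "ext_eq u v \<Longrightarrow> ext_eq v w \<Longrightarrow> ext_eq u w"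
proof (induction arbitrary: w rule: ext_eq.induct)
  case (1 u v)
  show ?case
  proof (rule ext_eq.intros; rule ballI)
    fix x assume "x \<in> pelems u"
    then obtain y where "y \<in> pelems v" and IH: "\<And>z. ext_eq y z \<Longrightarrow> ext_eq x z"
      using 1(1) by blast
    then show "\<exists>z\<in>pelems w. ext_eq x z" using ext_eqD(1)[OF 1(3)] by blast
  next
    fix z assume "z \<in> pelems w"
    then obtain y where y: "y \<in> pelems v" "ext_eq y z" using ext_eqD(2)[OF 1(3)] by blast
    then show "\<exists>x\<in>pelems u. ext_eq x z" using 1(2) by blast
  qed
qed

quotient_type 'k hset = "'k pset" / ext_eq
  by (intro equivpI reflpI sympI transpI) (fact ext_eq_refl, fact ext_eq_sym, fact ext_eq_trans)

lift_definition hmem :: "'k hset \<Rightarrow> 'k hset \<Rightarrow> bool" is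
  "\<lambda>x u. \<exists>y\<in>pelems u. ext_eq x y"
proof -
  fix x x' u u' :: "'k pset"
  assume eq: "ext_eq x x'" "ext_eq u u'"
  show "(\<exists>y\<in>pelems u. ext_eq x y) = (\<exists>y\<in>pelems u'. ext_eq x' y)"
    by (meson eq ext_eqD ext_eq_sym ext_eq_trans)
qed

lemma hmem_abs: "hmem z (abs_hset u) \<longleftrightarrow> (\<exists>y\<in>pelems u. z = abs_hset y)"
proof -
  obtain v where "z = abs_hset v" by (metis Quotient_abs_rep[OF Quotient_hset])
  then show ?thesis by (simp add: hmem.abs_eq hset.abs_eq_iff)
qed

text \<open>The following four facts characterise \<open>('k hset, hmem)\<close> up to isomorphism.\<close>

lemma hset_ext:
  assumes "\<And>z. hmem z x \<longleftrightarrow> hmem z y"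
  shows "x = y"
proof -
  obtain u v where uv: "x = abs_hset u" "y = abs_hset v"
    by (metis Quotient_abs_rep[OF Quotient_hset])
  have "ext_eq u v"
  proof (rule ext_eq.intros)
    show "\<forall>a\<in>pelems u. \<exists>b\<in>pelems v. ext_eq a b"
      using assms by (auto simp: uv hmem_abs hset.abs_eq_iff[symmetric])
    show "\<forall>b\<in>pelems v. \<exists>a\<in>pelems u. ext_eq a b"
    proof
      fix b assume "b \<in> pelems v"
      then have "hmem (abs_hset b) y" by (auto simp: uv hmem_abs)
      then have "hmem (abs_hset b) x" using assms by simp
      then obtain a where "a \<in> pelems u" "abs_hset a = abs_hset b" by (auto simp: uv hmem_abs)
      then show "\<exists>a\<in>pelems u. ext_eq a b" by (auto simp: hset.abs_eq_iff)
    qed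
  qed
  then show ?thesis by (simp add: uv hset.abs_eq_iff)
qed

lemma hset_wf: "wfp (hmem :: 'k hset \<Rightarrow> 'k hset \<Rightarrow> bool)"
proof (rule wfpUNIVI)
  fix P :: "'k hset \<Rightarrow> bool" and x
  assume step: "\<forall>x. (\<forall>y. hmem y x \<longrightarrow> P y) \<longrightarrow> P x"
  have "P (abs_hset u)" for u
  proof (induction u rule: pset_induct)
    case (1 u)
    have "P y" if "hmem y (abs_hset u)" for y
      using that 1 by (auto simp: hmem_abs)
    then show ?case using step by blast
  qed
  then show "P x" by (metis Quotient_abs_rep[OF Quotient_hset])
qed

lemma hset_small: "|{z. hmem z x}| \<le>o |UNIV :: 'k set|" for x :: "'k hset"
proof -
  obtain f where u: "x = abs_hset (PSet f)"
    by (metis Quotient_abs_rep[OF Quotient_hset] pset.exhaust)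
  have "{z. hmem z x} \<subseteq> (\<lambda>a. abs_hset (the (f a))) ` UNIV"
  proof
    fix z assume "z \<in> {z. hmem z x}"
    then obtain y where "y \<in> ran f" "z = abs_hset y"
      by (auto simp: u hmem_abs)
    then obtain a where "z = abs_hset (the (f a))" by (auto simp: ran_def) (metis option.sel)
    then show "z \<in> (\<lambda>a. abs_hset (the (f a))) ` UNIV" by blast
  qed
  then show ?thesis
    by (rule ordLeq_transitive[OF card_of_mono1 card_of_image])
qed

lemma hset_comprehension:
  fixes A :: "'k hset set"
  assumes "|A| \<le>o |UNIV :: 'k set|"
  shows "\<exists>x. \<forall>z. hmem z x \<longleftrightarrow> z \<in> A"
proof -
  obtain g :: "'k hset \<Rightarrow> 'k" where g: "inj_on g A"
    using card_of_ordLeq[THEN iffD2, OF assms] by (elim exE conjE)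
  define f where "f a = (if a \<in> g ` A then Some (rep_hset (inv_into A g a)) else None)" for a
  have ran: "ran f = rep_hset ` A"
  proof
    show "ran f \<subseteq> rep_hset ` A"
      using g by (auto simp: f_def ran_def split: if_splits)
    show "rep_hset ` A \<subseteq> ran f"
    proof
      fix u assume "u \<in> rep_hset ` A"
      then obtain x where "x \<in> A" "u = rep_hset x" by blast
      then have "f (g x) = Some u" using g by (simp add: f_def)
      then show "u \<in> ran f" by (rule ranI)
    qed
  qed
  have "hmem z (abs_hset (PSet f)) \<longleftrightarrow> z \<in> A" for z
    by (simp add: hmem_abs ran Quotient_abs_rep[OF Quotient_hset])
  then show ?thesis by blast
qed

definition trcl :: "'k hset \<Rightarrow> 'k hset set" where
  "trcl x = {y. hmem\<^sup>+\<^sup>+ y x}"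

definition H_kappa :: "'k::wellorder hset set" where
  "H_kappa = {x. |trcl x| <o (kappa :: 'k rel)}"


subsection \<open>Ordinals below \<open>\<kappa>\<close>\<close>

definition ord_zero :: "'k::wellorder" where
  "ord_zero = (LEAST x. True)"

definition limit_ord :: "'k::wellorder \<Rightarrow> bool" where
  "limit_ord \<alpha> \<longleftrightarrow> ord_zero < \<alpha> \<and> (\<forall>\<beta><\<alpha>. \<exists>\<gamma><\<alpha>. \<beta> < \<gamma>)"

definition ord_omega :: "'k::wellorder" where
  "ord_omega = (LEAST \<alpha>. limit_ord \<alpha>)"

text \<open>The supremum of a set of ordinals; it is only meaningful for sets bounded below \<open>\<kappa>\<close>.\<close>

definition osup :: "'k::wellorder set \<Rightarrow> 'k" where
  "osup A = (LEAST \<beta>. \<forall>\<alpha>\<in>A. \<alpha> \<le> \<beta>)"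

definition cf :: "'k::wellorder \<Rightarrow> 'k" where
  "cf \<alpha> = (LEAST \<beta>. \<exists>f. f ` {..<\<beta>} \<subseteq> {..<\<alpha>} \<and> (\<forall>\<gamma><\<alpha>. \<exists>\<delta><\<beta>. \<gamma> \<le> f \<delta>))"

definition E_gt_omega :: "'k::wellorder set" where
  "E_gt_omega = {\<alpha>. ord_omega < cf \<alpha>}"

definition acc_pts :: "'k::wellorder set \<Rightarrow> 'k set" where
  "acc_pts C = {\<alpha>\<in>C. osup (C \<inter> {..<\<alpha>}) = \<alpha> \<and> ord_zero < \<alpha>}"

definition nacc_pts :: "'k::wellorder set \<Rightarrow> 'k set" where
  "nacc_pts C = C - acc_pts C"

text \<open>\<open>X\<close> is an ordinal \<open>\<le> \<kappa>\<close>, i.e. \<open>{..<\<alpha>}\<close> or \<open>UNIV\<close>; closedness is in its order topology.\<close>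

definition closed_subset :: "'k::wellorder set \<Rightarrow> 'k set \<Rightarrow> bool" where
  "closed_subset X C \<longleftrightarrow>
     C \<subseteq> X \<and> (\<forall>\<gamma>\<in>X. ord_zero < \<gamma> \<and> osup (C \<inter> {..<\<gamma>}) = \<gamma> \<longrightarrow> \<gamma> \<in> C)"

definition cofinal_kappa :: "'k::wellorder set \<Rightarrow> bool" where
  "cofinal_kappa B \<longleftrightarrow> (\<forall>\<alpha>. \<exists>\<beta>\<in>B. \<alpha> \<le> \<beta>)"

definition club :: "'k::wellorder set \<Rightarrow> bool" where
  "club C \<longleftrightarrow> closed_subset UNIV C \<and> cofinal_kappa C"

definition stationary :: "'k::wellorder set \<Rightarrow> bool" where
  "stationary S \<longleftrightarrow> (\<forall>C. club C \<longrightarrow> S \<inter> C \<noteq> {})"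

text \<open>The relations below are only applied to sets bounded in \<open>\<kappa>\<close>, so that \<open>\<beta> < \<kappa>\<close> suffices.\<close>

definition init_seg :: "'k::wellorder set \<Rightarrow> 'k set \<Rightarrow> bool"  (infix "\<sqsubseteq>\<^sub>i" 50) where
  "D \<sqsubseteq>\<^sub>i C \<longleftrightarrow> (\<exists>\<beta>. D = C \<inter> {..<\<beta>})"

definition init_seg_star :: "'k::wellorder set \<Rightarrow> 'k set \<Rightarrow> bool"  (infix "\<sqsubseteq>\<^sub>*" 50) where
  "D \<sqsubseteq>\<^sub>* C \<longleftrightarrow> (\<exists>\<epsilon> < osup D. (D - {..<\<epsilon>}) \<sqsubseteq>\<^sub>i (C - {..<\<epsilon>}))"


subsection \<open>Diamond and the proxy principle\<close>

definition diamond :: "'k::wellorder itself \<Rightarrow> bool" where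
  "diamond _ \<longleftrightarrow>
     (\<exists>S :: 'k \<Rightarrow> 'k set. (\<forall>\<alpha>. S \<alpha> \<subseteq> {..<\<alpha>}) \<and>
        (\<forall>A. stationary {\<alpha>. A \<inter> {..<\<alpha>} = S \<alpha>}))"

text \<open>\<open>proxy_P \<mu> R\<close> is \<open>P(\<kappa>, \<mu>, R, 1)\<close>.\<close>

definition proxy_P :: "'m rel \<Rightarrow> ('k::wellorder set \<Rightarrow> 'k set \<Rightarrow> bool) \<Rightarrow> bool" where
  "proxy_P \<mu> R \<longleftrightarrow>
     diamond TYPE('k) \<and>
     (\<exists>\<C> :: 'k \<Rightarrow> 'k set set.
        (\<forall>\<alpha>. \<C> \<alpha> \<noteq> {} \<and> |\<C> \<alpha>| <o \<mu> \<and>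
             (\<forall>C\<in>\<C> \<alpha>. closed_subset {..<\<alpha>} C \<and> osup C = osup {..<\<alpha>})) \<and>
        (\<forall>\<alpha>. \<forall>C\<in>\<C> \<alpha>. \<forall>\<alpha>'\<in>acc_pts C. \<exists>D\<in>\<C> \<alpha>'. R D C) \<and>
        (\<forall>B. cofinal_kappa B \<longrightarrow>
             stationary {\<alpha>. \<forall>C\<in>\<C> \<alpha>. osup (nacc_pts C \<inter> B) = \<alpha>}))"


subsection \<open>Streamlined trees\<close>

text \<open>
  A function with domain \<open>\<alpha> < \<kappa>\<close> is a partial map with domain \<open>{..<\<alpha>}\<close>, and inclusion of
  functions is \<open>(\<subseteq>\<^sub>m)\<close>.
\<close>

type_synonym 'k node = "'k \<rightharpoonup> 'k hset"

definition seqs :: "'k::wellorder \<Rightarrow> 'k node set" where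
  "seqs \<alpha> = {t. dom t = {..<\<alpha>} \<and> ran t \<subseteq> H_kappa}"

definition level :: "'k::wellorder node set \<Rightarrow> 'k \<Rightarrow> 'k node set" where
  "level T \<alpha> = T \<inter> seqs \<alpha>"

definition streamlined_tree :: "'k::wellorder node set \<Rightarrow> bool" where
  "streamlined_tree T \<longleftrightarrow>
     T \<subseteq> (\<Union>\<alpha>. seqs \<alpha>) \<and>
     (\<forall>t\<in>T. \<forall>\<beta>. t |` {..<\<beta>} \<in> T) \<and>
     (\<forall>\<alpha>. level T \<alpha> \<noteq> {} \<and> |level T \<alpha>| <o (kappa :: 'k rel))"

definition below :: "'k node \<Rightarrow> 'k node \<Rightarrow> bool"  (infix "\<subset>\<^sub>m" 50) where
  "s \<subset>\<^sub>m t \<longleftrightarrow> s \<subseteq>\<^sub>m t \<and> s \<noteq> t"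

definition ht :: "'k::wellorder node \<Rightarrow> 'k" where
  "ht t = (THE \<alpha>. dom t = {..<\<alpha>})"

lemma ht_eq: "dom t = {..<\<alpha>} \<Longrightarrow> ht t = \<alpha>"
  unfolding ht_def by (rule the_equality) auto

text \<open>
  \<open>ht t\<close> is the height of \<open>t\<close> in \<open>(T, \<subset>\<^sub>m)\<close>, i.e. the order type of its set of predecessors.
\<close>

lemma ht_order_type:
  assumes T: "streamlined_tree T" and t: "t \<in> T"
  shows "bij_betw ht {s\<in>T. s \<subset>\<^sub>m t} {..<ht t}"
    and "\<And>r s. r \<in> T \<Longrightarrow> s \<in> T \<Longrightarrow> r \<subset>\<^sub>m t \<Longrightarrow> s \<subset>\<^sub>m t \<Longrightarrow> r \<subset>\<^sub>m s \<longleftrightarrow> ht r < ht s"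
proof -
  have dom: "dom s = {..<ht s}" if s: "s \<in> T" for s
  proof -
    from T s obtain \<alpha> where "dom s = {..<\<alpha>}"
      by (auto simp: streamlined_tree_def seqs_def)
    then show ?thesis using ht_eq by metis
  qed
  have res: "s = t |` {..<ht s}" if "s \<in> T" "s \<subset>\<^sub>m t" for s
  proof
    fix x show "s x = (t |` {..<ht s}) x"
      using that dom[OF that(1)]
      by (cases "x < ht s") (auto simp: below_def map_le_def restrict_map_def)
  qed
  have lt: "ht s < ht t" if s: "s \<in> T" "s \<subset>\<^sub>m t" for s
  proof (rule ccontr)
    assume "\<not> ht s < ht t"
    then have "dom t \<subseteq> {..<ht s}" using dom[OF t] by auto
    then have "t |` {..<ht s} = t"
      by (intro ext) (metis domIff lessThan_iff restrict_map_def subsetD)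
    then show False using res[OF s] s(2) by (simp add: below_def)
  qed
  have ht_res: "ht (t |` {..<\<alpha>}) = \<alpha>" if "\<alpha> \<le> ht t" for \<alpha>
    using that dom[OF t] by (intro ht_eq) auto
  show "bij_betw ht {s\<in>T. s \<subset>\<^sub>m t} {..<ht t}"
  proof (rule bij_betw_imageI)
    show "inj_on ht {s\<in>T. s \<subset>\<^sub>m t}"
      by (rule inj_onI) (metis (mono_tags, lifting) mem_Collect_eq res)
    have "\<alpha> \<in> ht ` {s\<in>T. s \<subset>\<^sub>m t}" if \<alpha>: "\<alpha> < ht t" for \<alpha>
    proof -
      have h: "ht (t |` {..<\<alpha>}) = \<alpha>" using \<alpha> by (intro ht_res) simp
      moreover have "t |` {..<\<alpha>} \<in> T" using T t by (simp add: streamlined_tree_def)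
      moreover have "t |` {..<\<alpha>} \<noteq> t" using h \<alpha> by auto
      then have "t |` {..<\<alpha>} \<subset>\<^sub>m t"
        by (auto simp: below_def map_le_def restrict_map_def)
      ultimately show ?thesis by force
    qed
    then show "ht ` {s\<in>T. s \<subset>\<^sub>m t} = {..<ht t}" using lt by auto
  qed
  show "r \<subset>\<^sub>m s \<longleftrightarrow> ht r < ht s" if "r \<in> T" "s \<in> T" "r \<subset>\<^sub>m t" "s \<subset>\<^sub>m t" for r s
  proof
    assume rs: "r \<subset>\<^sub>m s"
    then have "dom r \<subseteq> dom s" by (simp add: below_def map_le_implies_dom_le)
    then have "ht r \<le> ht s" using dom that by auto
    moreover have "ht r \<noteq> ht s" using rs res that by (metis below_def)
    ultimately show "ht r < ht s" by simp
  next
    assume less: "ht r < ht s"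
    have "r \<subseteq>\<^sub>m s"
      unfolding map_le_def
    proof
      fix x assume "x \<in> dom r"
      then have "x < ht r" "x < ht s" using less dom[OF that(1)] by auto
      then show "r x = s x"
        using fun_cong[OF res[OF that(1,3)], of x] fun_cong[OF res[OF that(2,4)], of x]
        by simp
    qed
    then show "r \<subset>\<^sub>m s" using less by (auto simp: below_def)
  qed
qed

definition normal_tree :: "'k::wellorder node set \<Rightarrow> bool" where
  "normal_tree T \<longleftrightarrow>
     (\<forall>\<alpha> \<beta>. \<alpha> < \<beta> \<longrightarrow> (\<forall>s\<in>level T \<alpha>. \<exists>t\<in>level T \<beta>. s \<subset>\<^sub>m t))"

definition imm_succs :: "'k::wellorder node set \<Rightarrow> 'k node \<Rightarrow> 'k node set" where
  "imm_succs T s = {t\<in>T. s \<subset>\<^sub>m t \<and> \<not> (\<exists>u\<in>T. s \<subset>\<^sub>m u \<and> u \<subset>\<^sub>m t)}"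

definition splitting_tree :: "'k::wellorder node set \<Rightarrow> bool" where
  "splitting_tree T \<longleftrightarrow> (\<forall>s\<in>T. \<exists>t\<in>imm_succs T s. \<exists>u\<in>imm_succs T s. t \<noteq> u)"

text \<open>
  \<open>X\<close> is the ordinal \<open>{..<\<alpha>}\<close> for \<open>\<alpha>\<close>-branches and \<open>UNIV\<close> for \<open>\<kappa>\<close>-branches.
\<close>

definition branch :: "'k::wellorder node set \<Rightarrow> 'k set \<Rightarrow> 'k node set \<Rightarrow> bool" where
  "branch T X B \<longleftrightarrow>
     B \<subseteq> T \<and> (\<forall>s\<in>B. \<forall>t\<in>B. s \<subset>\<^sub>m t \<or> s = t \<or> t \<subset>\<^sub>m s) \<and> ht ` B = X"

definition antichain :: "'k::wellorder node set \<Rightarrow> 'k node set \<Rightarrow> bool" where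
  "antichain T A \<longleftrightarrow> A \<subseteq> T \<and> (\<forall>s\<in>A. \<forall>t\<in>A. \<not> s \<subset>\<^sub>m t)"

definition souslin_tree :: "'k::wellorder node set \<Rightarrow> bool" where
  "souslin_tree T \<longleftrightarrow>
     streamlined_tree T \<and>
     \<not> (\<exists>B. branch T UNIV B) \<and>
     \<not> (\<exists>A. antichain T A \<and> |A| =o (kappa :: 'k rel))"

definition vanishing :: "'k::wellorder node set \<Rightarrow> 'k node set \<Rightarrow> bool" where
  "vanishing T B \<longleftrightarrow> \<not> (\<exists>t\<in>T. \<forall>s\<in>B. s \<subseteq>\<^sub>m t)"

definition V_minus :: "'k::wellorder node set \<Rightarrow> 'k set" where
  "V_minus T = {\<alpha>. limit_ord \<alpha> \<and> (\<exists>B. branch T {..<\<alpha>} B \<and> vanishing T B)}"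

definition V_full :: "'k::wellorder node set \<Rightarrow> 'k set" where
  "V_full T =
     {\<alpha>. limit_ord \<alpha> \<and>
         (\<forall>s\<in>T. ht s < \<alpha> \<longrightarrow> (\<exists>B. branch T {..<\<alpha>} B \<and> vanishing T B \<and> s \<in> B))}"

end

theory Submission
  imports Defs
begin

text \<open>
  Both hypotheses give \<open>P(\<kappa>, \<kappa>, \<sqsubseteq>\<^sup>*, 1)\<close>, from which \<open>T\<close> is built level by level. A node of
  limit height \<open>\<alpha>\<close> is obtained from some \<open>C \<in> \<C> \<alpha>\<close>, some \<open>\<eta> \<in> K\<^sub>\<alpha>\<close> and a node whose height
  lies in \<open>C\<close> by climbing along \<open>C\<close>: at each \<open>\<delta> \<in> C\<close> one first appends a code of the restriction of
  \<open>\<eta>\<close> to \<open>\<delta>\<close> and then moves to the level of the next element of \<open>C\<close>, passing, if possible, through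
  the dense set guessed there by the diamond sequence. Coherence of the \<open>C\<close>-sequence keeps the climb
  inside \<open>T\<close> at accumulation points of \<open>C\<close>, and the hitting property of the \<open>C\<close>-sequence makes
  every dense subset of \<open>T\<close> sealed at some level, so \<open>T\<close> is Souslin.

  The same climb is possible along the limit \<open>\<eta>\<close> of a vanishing \<open>\<alpha>\<close>-branch of \<open>K\<close>. If the
  resulting branch had an upper bound in \<open>T\<close>, then it would also arise from some \<open>D \<in> \<C> \<alpha>\<close> and
  \<open>\<xi> \<in> K\<^sub>\<alpha>\<close>; decoding at the points of \<open>C \<inter> D\<close> yields \<open>\<eta> = \<xi> \<in> K\<close>, provided that \<open>C \<inter> D\<close> is
  cofinal in \<open>\<alpha>\<close>. This is trivial if \<open>\<C> \<alpha>\<close> is a singleton, and follows from closedness if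
  \<open>cf \<alpha> > \<omega>\<close>.
\<close>

section \<open>Ordinals and closed sets\<close>

lemma ord_zero_le: "ord_zero \<le> (\<alpha> :: 'a::wellorder)"
  unfolding ord_zero_def by (rule Least_le) simp

lemma not_less_ord_zero: "\<not> \<alpha> < (ord_zero :: 'a::wellorder)"
  using ord_zero_le by (simp add: not_less)

lemma lessThan_ord_zero: "{..<ord_zero} = ({} :: 'a::wellorder set)"
  using not_less_ord_zero by auto

lemma ord_zero_less: "\<beta> < \<alpha> \<Longrightarrow> ord_zero < (\<alpha> :: 'a::wellorder)"
  using ord_zero_le[of \<beta>] by simp

lemma osup_upper:
  fixes A :: "'a::wellorder set"
  assumes "A \<subseteq> {..\<beta>}" "\<alpha> \<in> A"
  shows "\<alpha> \<le> osup A"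
proof -
  have "\<forall>\<alpha>\<in>A. \<alpha> \<le> osup A"
    unfolding osup_def by (rule LeastI[of _ \<beta>]) (use assms(1) in auto)
  then show ?thesis using assms(2) by blast
qed

lemma osup_least: "A \<subseteq> {..\<beta> :: 'a::wellorder} \<Longrightarrow> osup A \<le> \<beta>"
  unfolding osup_def by (rule Least_le) auto

lemma less_osupD: "\<beta> < osup (A :: 'a::wellorder set) \<Longrightarrow> \<exists>\<alpha>\<in>A. \<beta> < \<alpha>"
  unfolding osup_def by (drule not_less_Least) (auto simp: not_le)

definition cofinal_in :: "'a::wellorder set \<Rightarrow> 'a \<Rightarrow> bool" where
  "cofinal_in C \<alpha> \<longleftrightarrow> (\<forall>\<beta><\<alpha>. \<exists>\<gamma>\<in>C. \<beta> < \<gamma> \<and> \<gamma> < \<alpha>)"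

lemma cofinal_inD: "cofinal_in C \<alpha> \<Longrightarrow> \<beta> < \<alpha> \<Longrightarrow> \<exists>\<gamma>\<in>C. \<beta> < \<gamma> \<and> \<gamma> < \<alpha>"
  unfolding cofinal_in_def by blast

lemma cofinal_in_mono: "cofinal_in C \<alpha> \<Longrightarrow> C \<subseteq> D \<Longrightarrow> cofinal_in D \<alpha>"
  unfolding cofinal_in_def by blast

lemma cofinal_in_Int_atLeast:
  assumes "cofinal_in C \<alpha>" "\<gamma> < \<alpha>"
  shows "cofinal_in (C \<inter> {\<gamma>..}) \<alpha>"
  unfolding cofinal_in_def
proof (intro allI impI)
  fix \<beta> assume "\<beta> < \<alpha>"
  then have "max \<beta> \<gamma> < \<alpha>" using assms(2) by simp
  then obtain \<delta> where "\<delta> \<in> C" "max \<beta> \<gamma> < \<delta>" "\<delta> < \<alpha>"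
    using cofinal_inD[OF assms(1)] by blast
  then show "\<exists>\<delta>\<in>C \<inter> {\<gamma>..}. \<beta> < \<delta> \<and> \<delta> < \<alpha>" by auto
qed

lemma cofinal_in_UNIV_if_limit_ord: "limit_ord \<alpha> \<Longrightarrow> cofinal_in UNIV \<alpha>"
  by (auto simp: limit_ord_def cofinal_in_def)

lemma limit_ord_if_cofinal_in: "cofinal_in C \<alpha> \<Longrightarrow> ord_zero < \<alpha> \<Longrightarrow> limit_ord \<alpha>"
  by (auto simp: limit_ord_def cofinal_in_def)

lemma osup_Int_lessThan_eq_iff:
  "osup (C \<inter> {..<\<alpha>}) = \<alpha> \<longleftrightarrow> cofinal_in C (\<alpha> :: 'a::wellorder)"
proof
  assume eq: "osup (C \<inter> {..<\<alpha>}) = \<alpha>"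
  show "cofinal_in C \<alpha>"
    unfolding cofinal_in_def
  proof (intro allI impI)
    fix \<beta> assume "\<beta> < \<alpha>"
    then obtain \<gamma> where "\<gamma> \<in> C \<inter> {..<\<alpha>}" "\<beta> < \<gamma>"
      using eq less_osupD[of \<beta> "C \<inter> {..<\<alpha>}"] by auto
    then show "\<exists>\<gamma>\<in>C. \<beta> < \<gamma> \<and> \<gamma> < \<alpha>" by auto
  qed
next
  assume cof: "cofinal_in C \<alpha>"
  have sub: "C \<inter> {..<\<alpha>} \<subseteq> {..\<alpha>}" by auto
  show "osup (C \<inter> {..<\<alpha>}) = \<alpha>"
  proof (rule antisym[OF osup_least[OF sub]], rule leI, rule notI)
    assume "osup (C \<inter> {..<\<alpha>}) < \<alpha>"
    then obtain \<gamma> where "\<gamma> \<in> C" "osup (C \<inter> {..<\<alpha>}) < \<gamma>" "\<gamma> < \<alpha>"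
      using cofinal_inD[OF cof] by blast
    then show False using osup_upper[OF sub, of \<gamma>] by auto
  qed
qed

lemma osup_lessThan: "limit_ord \<alpha> \<Longrightarrow> osup {..<\<alpha>} = (\<alpha> :: 'a::wellorder)"
  using osup_Int_lessThan_eq_iff[of UNIV \<alpha>] cofinal_in_UNIV_if_limit_ord by simp

lemma acc_pts_iff: "\<alpha> \<in> acc_pts C \<longleftrightarrow> \<alpha> \<in> C \<and> ord_zero < \<alpha> \<and> cofinal_in C \<alpha>"
  by (auto simp: acc_pts_def osup_Int_lessThan_eq_iff)

lemma acc_pts_limit_ord: "\<alpha> \<in> acc_pts C \<Longrightarrow> limit_ord \<alpha>"
  using limit_ord_if_cofinal_in by (auto simp: acc_pts_iff)

lemma closed_subset_iff:
  "closed_subset X C \<longleftrightarrow> C \<subseteq> X \<and> (\<forall>\<gamma>\<in>X. ord_zero < \<gamma> \<and> cofinal_in C \<gamma> \<longrightarrow> \<gamma> \<in> C)"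
  by (simp add: closed_subset_def osup_Int_lessThan_eq_iff)

lemma
  fixes s :: "nat \<Rightarrow> 'a::wellorder"
  assumes mono: "strict_mono s" and bdd: "range s \<subseteq> {..\<beta>}"
  shows strict_mono_less_osup: "s n < osup (range s)"
    and strict_mono_cofinal_in_osup: "cofinal_in (range s) (osup (range s))"
proof -
  have less: "s n < osup (range s)" for n
  proof -
    have "s n < s (Suc n)" using mono by (simp add: strict_mono_Suc_iff)
    also have "\<dots> \<le> osup (range s)" by (rule osup_upper[OF bdd]) simp
    finally show ?thesis .
  qed
  then show "s n < osup (range s)" .
  show "cofinal_in (range s) (osup (range s))"
    unfolding cofinal_in_def using less less_osupD by blast
qed

lemma closed_closure_points:
  fixes f :: "'a::wellorder \<Rightarrow> 'a"
  shows "closed_subset UNIV {\<beta>. limit_ord \<beta> \<and> (\<forall>\<gamma><\<beta>. f \<gamma> < \<beta>)}" (is "closed_subset UNIV ?E")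
  unfolding closed_subset_iff
proof (intro conjI ballI impI)
  fix \<gamma> :: 'a
  assume \<gamma>: "ord_zero < \<gamma> \<and> cofinal_in ?E \<gamma>"
  then have "limit_ord \<gamma>" using limit_ord_if_cofinal_in by blast
  moreover have "f \<beta> < \<gamma>" if "\<beta> < \<gamma>" for \<beta>
  proof -
    obtain \<delta> where "\<delta> \<in> ?E" "\<beta> < \<delta>" "\<delta> < \<gamma>" using \<gamma> \<open>\<beta> < \<gamma>\<close> by (blast dest: cofinal_inD)
    then show ?thesis by (auto intro: less_trans)
  qed
  ultimately show "\<gamma> \<in> ?E" by blast
qed simp

definition consecutive :: "'a::wellorder set \<Rightarrow> 'a \<Rightarrow> 'a \<Rightarrow> bool" where
  "consecutive C \<delta> \<delta>' \<longleftrightarrow> \<delta> \<in> C \<and> \<delta>' \<in> C \<and> \<delta> < \<delta>' \<and> (\<forall>\<beta>\<in>C. \<beta> < \<delta>' \<longrightarrow> \<beta> \<le> \<delta>)"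

lemma nacc_pts_predecessor:
  assumes closed: "closed_subset {..<\<alpha>} C" and \<delta>: "\<delta> \<in> nacc_pts C" and \<gamma>: "\<gamma> \<in> C" "\<gamma> < \<delta>"
  obtains \<delta>' where "\<gamma> \<le> \<delta>'" "consecutive C \<delta>' \<delta>"
proof -
  define A where "A = C \<inter> {..<\<delta>}"
  define \<sigma> where "\<sigma> = osup A"
  have A: "A \<subseteq> {..\<delta>}" "\<gamma> \<in> A" using \<gamma> by (auto simp: A_def)
  have upper: "\<beta> \<le> \<sigma>" if "\<beta> \<in> A" for \<beta> unfolding \<sigma>_def using A(1) that by (rule osup_upper)
  have "\<delta> \<in> C" "\<delta> < \<alpha>" using \<delta> closed by (auto simp: nacc_pts_def closed_subset_def)
  have "\<sigma> \<in> A"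
  proof (rule ccontr)
    assume "\<sigma> \<notin> A"
    then have less: "\<beta> < \<sigma>" if "\<beta> \<in> A" for \<beta> using upper[OF that] that by (metis order_less_le)
    then have "cofinal_in A \<sigma>"
      unfolding cofinal_in_def \<sigma>_def using less_osupD by blast
    then have cof: "cofinal_in C \<sigma>" by (rule cofinal_in_mono) (simp add: A_def)
    have "ord_zero < \<sigma>" using less[OF A(2)] by (rule ord_zero_less)
    moreover have "\<sigma> \<le> \<delta>" unfolding \<sigma>_def using A(1) by (rule osup_least)
    moreover have "\<sigma> \<noteq> \<delta>"
      using \<delta> cof \<open>ord_zero < \<sigma>\<close> by (auto simp: nacc_pts_def acc_pts_iff)
    ultimately show False
      using closed cof \<open>\<delta> < \<alpha>\<close> \<open>\<sigma> \<notin> A\<close> by (auto simp: closed_subset_iff A_def)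
  qed
  then have "consecutive C \<sigma> \<delta>"
    using \<open>\<delta> \<in> C\<close> upper by (auto simp: consecutive_def A_def)
  with upper[OF A(2)] show thesis by (rule that)
qed

lemma closed_subset_induct [consumes 4, case_names base succ limit]:
  assumes closed: "closed_subset {..<\<alpha>} C" and \<gamma>: "\<gamma> \<in> C" and "\<delta> \<in> C" "\<gamma> \<le> \<delta>"
    and base: "P \<gamma>"
    and succ: "\<And>\<delta> \<delta>'. consecutive C \<delta> \<delta>' \<Longrightarrow> \<gamma> \<le> \<delta> \<Longrightarrow> P \<delta> \<Longrightarrow> P \<delta>'"
    and limit: "\<And>\<delta>. \<delta> \<in> acc_pts C \<Longrightarrow> \<gamma> < \<delta> \<Longrightarrow>
      (\<And>\<beta>. \<beta> \<in> C \<Longrightarrow> \<gamma> \<le> \<beta> \<Longrightarrow> \<beta> < \<delta> \<Longrightarrow> P \<beta>) \<Longrightarrow> P \<delta>"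
  shows "P \<delta>"
  using assms(3,4)
proof (induction \<delta> rule: less_induct)
  case (less \<delta>)
  consider "\<delta> = \<gamma>" | "\<gamma> < \<delta>" "\<delta> \<in> acc_pts C" | "\<gamma> < \<delta>" "\<delta> \<in> nacc_pts C"
    using less.prems by (auto simp: nacc_pts_def order_less_le)
  then show ?case
  proof cases
    case 1
    then show ?thesis using base by simp
  next
    case 2
    show ?thesis using 2(2,1) less.IH by (rule limit)
  next
    case 3
    obtain \<delta>' where "\<gamma> \<le> \<delta>'" "consecutive C \<delta>' \<delta>"
      using nacc_pts_predecessor[OF closed 3(2) \<gamma> 3(1)] by blast
    moreover from this have "P \<delta>'" by (intro less.IH) (simp_all add: consecutive_def)
    ultimately show ?thesis using succ by blast
  qed
qed

section \<open>Regular cardinals\<close>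

locale regular_cardinal =
  fixes ty :: "'k::wellorder itself"
  assumes Card_order_kappa: "Card_order (kappa :: 'k rel)"
    and regularCard_kappa: "regularCard (kappa :: 'k rel)"
    and natLeq_ordLeq_kappa: "natLeq \<le>o (kappa :: 'k rel)"
begin

abbreviation cardinal_kappa :: "'k rel" ("\<kappa>") where
  "\<kappa> \<equiv> kappa"

lemma Field_kappa: "Field \<kappa> = UNIV"
  by (auto simp: kappa_def Field_def)

lemma card_of_UNIV_kappa: "|UNIV :: 'k set| =o \<kappa>"
  using card_of_Field_ordIso[OF Card_order_kappa] by (simp add: Field_kappa)

lemma Cinfinite_kappa: "Cinfinite \<kappa>"
  using cinfinite_mono[OF natLeq_ordLeq_kappa natLeq_cinfinite] Card_order_kappa by simp

lemma infinite_UNIV_kappa: "infinite (UNIV :: 'k set)"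
  using Cinfinite_kappa by (simp add: cinfinite_def Field_kappa)

lemma small_ordLeq_UNIV: "|A| <o \<kappa> \<Longrightarrow> |A| \<le>o |UNIV :: 'k set|"
  using card_of_UNIV_kappa by (meson ordIso_symmetric ordLess_imp_ordLeq ordLess_ordIso_trans)

lemma small_lessThan: "|{..<\<alpha> :: 'k}| <o \<kappa>"
proof -
  have "underS \<kappa> \<alpha> = {..<\<alpha>}"
    by (auto simp: underS_def kappa_def order_less_le)
  then show ?thesis
    using card_of_underS[OF Card_order_kappa, of \<alpha>] by (simp add: Field_kappa)
qed

lemma small_mono: "A \<subseteq> B \<Longrightarrow> |B| <o \<kappa> \<Longrightarrow> |A| <o \<kappa>"
  using card_of_mono1 ordLeq_ordLess_trans by blast

lemma small_image: "|A| <o \<kappa> \<Longrightarrow> |f ` A| <o \<kappa>"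
  using card_of_image ordLeq_ordLess_trans by blast

lemma small_finite: "finite A \<Longrightarrow> |A| <o \<kappa>"
  using finite_iff_ordLess_natLeq ordLess_ordLeq_trans natLeq_ordLeq_kappa by blast

lemma small_Un: "|A| <o \<kappa> \<Longrightarrow> |B| <o \<kappa> \<Longrightarrow> |A \<union> B| <o \<kappa>"
  using card_of_Un_ordLess_infinite_Field[OF _ Card_order_kappa]
  by (simp add: Field_kappa infinite_UNIV_kappa)

lemma small_UN: "|I| <o \<kappa> \<Longrightarrow> (\<And>i. i \<in> I \<Longrightarrow> |A i| <o \<kappa>) \<Longrightarrow> |\<Union>i\<in>I. A i| <o \<kappa>"
  using card_of_UNION_ordLess_infinite_Field_regularCard[OF regularCard_kappa Cinfinite_kappa]
  by blast

lemma small_Times: "|A| <o \<kappa> \<Longrightarrow> |B| <o \<kappa> \<Longrightarrow> |A \<times> B| <o \<kappa>"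
proof -
  assume "|A| <o \<kappa>" "|B| <o \<kappa>"
  then have "|\<Union>a\<in>A. Pair a ` B| <o \<kappa>" by (intro small_UN small_image)
  moreover have "A \<times> B = (\<Union>a\<in>A. Pair a ` B)" by auto
  ultimately show ?thesis by simp
qed

lemma ex_greater: "\<exists>\<beta>::'k. \<alpha> < \<beta>"
proof -
  obtain \<beta> where "\<alpha> \<noteq> \<beta>" "(\<alpha>, \<beta>) \<in> \<kappa>"
    using infinite_Card_order_limit[OF Card_order_kappa, of \<alpha>] infinite_UNIV_kappa
    by (auto simp: Field_kappa)
  then have "\<alpha> < \<beta>" by (simp add: kappa_def)
  then show ?thesis ..
qed

lemma small_bounded:
  assumes "|X :: 'k set| <o \<kappa>"
  obtains \<beta> where "X \<subseteq> {..<\<beta>}"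
proof -
  have "\<not> cofinal X \<kappa>"
    using assms regularCard_kappa not_ordLess_ordIso
    unfolding regularCard_def Field_kappa by blast
  then obtain \<alpha> where "\<forall>\<beta>\<in>X. \<beta> \<le> \<alpha>"
    unfolding cofinal_def Field_kappa
    by (metis (mono_tags, lifting) UNIV_I case_prodI kappa_def linear mem_Collect_eq order_refl)
  moreover obtain \<beta> where "\<alpha> < \<beta>" using ex_greater by blast
  ultimately have "X \<subseteq> {..<\<beta>}" by auto
  then show thesis by (rule that)
qed

definition osuc :: "'k \<Rightarrow> 'k" where
  "osuc \<alpha> = (LEAST \<beta>. \<alpha> < \<beta>)"

lemma less_osuc: "\<alpha> < osuc \<alpha>"
  unfolding osuc_def using ex_greater by (rule LeastI_ex)

lemma osuc_le: "\<alpha> < \<beta> \<Longrightarrow> osuc \<alpha> \<le> \<beta>"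
  unfolding osuc_def by (rule Least_le)

lemma less_osuc_iff: "\<beta> < osuc \<alpha> \<longleftrightarrow> \<beta> \<le> \<alpha>"
  using less_osuc osuc_le by (meson le_less_trans not_le)

lemma lessThan_osuc: "{..<osuc \<alpha>} = {..\<alpha>}"
  by (auto simp: less_osuc_iff)

lemma limit_ord_iff: "limit_ord (\<alpha>::'k) \<longleftrightarrow> \<alpha> \<noteq> ord_zero \<and> (\<nexists>\<gamma>. \<alpha> = osuc \<gamma>)"
proof
  assume limit: "limit_ord \<alpha>"
  then have "\<alpha> \<noteq> osuc \<gamma>" for \<gamma>
    using less_osuc[of \<gamma>] by (auto simp: limit_ord_def less_osuc_iff)
  with limit show "\<alpha> \<noteq> ord_zero \<and> (\<nexists>\<gamma>. \<alpha> = osuc \<gamma>)" by (auto simp: limit_ord_def)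
next
  assume no_pred: "\<alpha> \<noteq> ord_zero \<and> (\<nexists>\<gamma>. \<alpha> = osuc \<gamma>)"
  then have "osuc \<beta> < \<alpha>" if "\<beta> < \<alpha>" for \<beta>
    using osuc_le[OF that] by (metis order_less_le)
  with no_pred show "limit_ord \<alpha>"
    using ord_zero_le[of \<alpha>] less_osuc by (auto simp: limit_ord_def order_less_le)
qed

lemma osuc_less_limit: "limit_ord \<alpha> \<Longrightarrow> \<beta> < \<alpha> \<Longrightarrow> osuc \<beta> < (\<alpha>::'k)"
  using osuc_le by (fastforce simp: limit_ord_def)

lemma not_limit_ord_osuc: "\<not> limit_ord (osuc (\<alpha>::'k))"
  using limit_ord_iff by blast

lemma ord_cases [case_names zero succ limit]:
  obtains "(\<alpha>::'k) = ord_zero" | \<gamma> where "\<alpha> = osuc \<gamma>" | "limit_ord \<alpha>"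
  using limit_ord_iff by blast

end

locale regular_uncountable_cardinal = regular_cardinal ty
  for ty :: "'k::wellorder itself" +
  assumes natLeq_ordLess_kappa: "natLeq <o (kappa :: 'k rel)"
begin

lemma small_range_nat: "|range (f :: nat \<Rightarrow> 'a)| <o \<kappa>"
  by (meson card_of_image card_of_nat ordLeq_ordIso_trans ordLeq_ordLess_trans natLeq_ordLess_kappa)

lemma ex_closure_point:
  fixes f :: "'k \<Rightarrow> 'k"
  obtains \<beta> where "\<alpha> < \<beta>" "limit_ord \<beta>" "\<forall>\<gamma><\<beta>. f \<gamma> < \<beta>"
proof -
  have "\<exists>\<beta>. \<forall>\<delta>\<le>\<gamma>. f \<delta> < \<beta> \<and> \<delta> < \<beta>" for \<gamma>
  proof -
    have "|f ` {..<osuc \<gamma>} \<union> {..<osuc \<gamma>}| <o \<kappa>"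
      by (intro small_Un small_image small_lessThan)
    then obtain \<beta> where "f ` {..<osuc \<gamma>} \<union> {..<osuc \<gamma>} \<subseteq> {..<\<beta>}" by (rule small_bounded)
    then show ?thesis by (auto simp: lessThan_osuc)
  qed
  then obtain h where h: "\<And>\<gamma> \<delta>. \<delta> \<le> \<gamma> \<Longrightarrow> f \<delta> < h \<gamma> \<and> \<delta> < h \<gamma>" by metis
  define s where "s n = (h ^^ n) \<alpha>" for n
  have mono: "strict_mono s" using h by (simp add: strict_mono_Suc_iff s_def)
  obtain \<beta> where "range s \<subseteq> {..<\<beta>}" by (rule small_bounded[OF small_range_nat])
  then have bdd: "range s \<subseteq> {..\<beta>}" by auto
  define \<sigma> where "\<sigma> = osup (range s)"
  have s_less: "s n < \<sigma>" for n unfolding \<sigma>_def by (rule strict_mono_less_osup[OF mono bdd])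
  have cof: "cofinal_in (range s) \<sigma>"
    unfolding \<sigma>_def by (rule strict_mono_cofinal_in_osup[OF mono bdd])
  show thesis
  proof
    show "\<alpha> < \<sigma>" using s_less[of 0] by (simp add: s_def)
    then show "limit_ord \<sigma>" using limit_ord_if_cofinal_in[OF cof] ord_zero_less by blast
    show "\<forall>\<gamma><\<sigma>. f \<gamma> < \<sigma>"
    proof (intro allI impI)
      fix \<gamma> assume "\<gamma> < \<sigma>"
      then obtain n where "\<gamma> < s n" using cofinal_inD[OF cof] by blast
      then have "f \<gamma> < s (Suc n)" using h by (simp add: s_def)
      then show "f \<gamma> < \<sigma>" using s_less less_trans by blast
    qed
  qed
qed

lemma club_closure_points:
  fixes f :: "'k \<Rightarrow> 'k"
  shows "club {\<beta>. limit_ord \<beta> \<and> (\<forall>\<gamma><\<beta>. f \<gamma> < \<beta>)}"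
  unfolding club_def cofinal_kappa_def
proof (intro conjI allI closed_closure_points)
  fix \<alpha> :: 'k
  obtain \<beta> where "\<alpha> < \<beta>" "limit_ord \<beta>" "\<forall>\<gamma><\<beta>. f \<gamma> < \<beta>" by (rule ex_closure_point)
  then show "\<exists>\<beta>\<in>{\<beta>. limit_ord \<beta> \<and> (\<forall>\<gamma><\<beta>. f \<gamma> < \<beta>)}. \<alpha> \<le> \<beta>" by auto
qed

lemma stationary_closure_point:
  fixes f :: "'k \<Rightarrow> 'k"
  assumes "stationary S"
  obtains \<beta> where "\<beta> \<in> S" "\<alpha> < \<beta>" "limit_ord \<beta>" "\<And>\<gamma>. \<gamma> < \<beta> \<Longrightarrow> f \<gamma> < \<beta>"
proof -
  obtain \<beta> where \<beta>: "\<beta> \<in> S" "limit_ord \<beta>" "\<forall>\<gamma><\<beta>. max (f \<gamma>) \<alpha> < \<beta>"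
    using assms club_closure_points[of "\<lambda>\<gamma>. max (f \<gamma>) \<alpha>"] unfolding stationary_def by blast
  moreover from this have "ord_zero < \<beta>" by (simp add: limit_ord_def)
  ultimately show thesis using that by fastforce
qed

lemma limit_ord_omega: "limit_ord (ord_omega :: 'k)"
  unfolding ord_omega_def by (rule ex_closure_point[of _ id]) (rule LeastI)

lemma osup_range_nat_less:
  fixes s :: "nat \<Rightarrow> 'k"
  assumes \<alpha>: "\<alpha> \<in> E_gt_omega" and s: "\<And>n. s n < \<alpha>"
  shows "osup (range s) < \<alpha>"
proof (rule ccontr)
  assume unbounded: "\<not> osup (range s) < \<alpha>"
  define h where "h n = (osuc ^^ n) ord_zero" for n
  have h_less: "h n < ord_omega" for n
    by (induction n) (use limit_ord_omega osuc_less_limit in \<open>auto simp: h_def limit_ord_def\<close>)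
  have "strict_mono h" by (simp add: strict_mono_Suc_iff h_def less_osuc)
  then have "inj h" by (rule strict_mono_imp_inj_on)
  define f where "f \<delta> = s (inv h \<delta>)" for \<delta>
  have "f ` {..<ord_omega} \<subseteq> {..<\<alpha>}" using s by (auto simp: f_def)
  moreover have "\<exists>\<delta> < ord_omega. \<gamma> \<le> f \<delta>" if "\<gamma> < \<alpha>" for \<gamma>
  proof -
    have "\<gamma> < osup (range s)" using that unbounded by simp
    then obtain n where "\<gamma> < s n" using less_osupD by blast
    then have "\<gamma> \<le> f (h n)" using \<open>inj h\<close> by (simp add: f_def)
    then show ?thesis using h_less by blast
  qed
  ultimately have "cf \<alpha> \<le> ord_omega" unfolding cf_def by (intro Least_le) blast
  with \<alpha> show False by (simp add: E_gt_omega_def)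
qed

lemma closed_subset_Int_cofinal_in:
  fixes C D :: "'k set"
  assumes \<alpha>: "\<alpha> \<in> E_gt_omega"
    and C: "closed_subset {..<\<alpha>} C" "cofinal_in C \<alpha>"
    and D: "closed_subset {..<\<alpha>} D" "cofinal_in D \<alpha>"
  shows "cofinal_in (C \<inter> D) \<alpha>"
  unfolding cofinal_in_def
proof (intro allI impI)
  fix \<beta> assume \<beta>: "\<beta> < \<alpha>"
  obtain c where c: "\<And>\<gamma>. \<gamma> < \<alpha> \<Longrightarrow> c \<gamma> \<in> C \<and> \<gamma> < c \<gamma> \<and> c \<gamma> < \<alpha>"
    using C(2) unfolding cofinal_in_def by metis
  obtain d where d: "\<And>\<gamma>. \<gamma> < \<alpha> \<Longrightarrow> d \<gamma> \<in> D \<and> \<gamma> < d \<gamma> \<and> d \<gamma> < \<alpha>"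
    using D(2) unfolding cofinal_in_def by metis
  define s where "s n = ((d \<circ> c) ^^ n) \<beta>" for n
  have s_less: "s n < \<alpha>" for n by (induction n) (use c d \<beta> in \<open>auto simp: s_def\<close>)
  have cs: "c (s n) \<in> C" "s n < c (s n)" "c (s n) < s (Suc n)" and ds: "s (Suc n) \<in> D" for n
    using c[OF s_less] d[of "c (s n)"] by (auto simp: s_def)
  have mono: "strict_mono s" unfolding strict_mono_Suc_iff using cs less_trans by blast
  have bdd: "range s \<subseteq> {..\<alpha>}" using s_less by (auto intro: less_imp_le)
  define \<sigma> where "\<sigma> = osup (range s)"
  have "\<sigma> < \<alpha>" unfolding \<sigma>_def by (rule osup_range_nat_less[OF \<alpha> s_less])
  have s\<sigma>: "s n < \<sigma>" for n unfolding \<sigma>_def by (rule strict_mono_less_osup[OF mono bdd])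
  have "\<exists>n. \<gamma> < s n" if "\<gamma> < \<sigma>" for \<gamma>
    using that unfolding \<sigma>_def by (blast dest: less_osupD)
  then have "cofinal_in C \<sigma>" "cofinal_in D \<sigma>"
    unfolding cofinal_in_def using cs ds s\<sigma> by (meson less_trans)+
  moreover have "\<beta> < \<sigma>" using s\<sigma>[of 0] by (simp add: s_def)
  ultimately have "\<sigma> \<in> C \<inter> D"
    using C(1) D(1) \<open>\<sigma> < \<alpha>\<close> ord_zero_less by (auto simp: closed_subset_iff)
  then show "\<exists>\<gamma>\<in>C \<inter> D. \<beta> < \<gamma> \<and> \<gamma> < \<alpha>" using \<open>\<beta> < \<sigma>\<close> \<open>\<sigma> < \<alpha>\<close> by blast
qed

end

section \<open>Proxy sequences\<close>

definition proxy_sequence ::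
    "'m rel \<Rightarrow> ('k::wellorder set \<Rightarrow> 'k set \<Rightarrow> bool) \<Rightarrow> ('k \<Rightarrow> 'k set set) \<Rightarrow> bool" where
  "proxy_sequence \<mu> R \<C> \<longleftrightarrow>
     (\<forall>\<alpha>. \<C> \<alpha> \<noteq> {} \<and> |\<C> \<alpha>| <o \<mu> \<and>
        (\<forall>C\<in>\<C> \<alpha>. closed_subset {..<\<alpha>} C \<and> osup C = osup {..<\<alpha>})) \<and>
     (\<forall>\<alpha>. \<forall>C\<in>\<C> \<alpha>. \<forall>\<alpha>'\<in>acc_pts C. \<exists>D\<in>\<C> \<alpha>'. R D C) \<and>
     (\<forall>B. cofinal_kappa B \<longrightarrow> stationary {\<alpha>. \<forall>C\<in>\<C> \<alpha>. osup (nacc_pts C \<inter> B) = \<alpha>})"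

lemma proxy_P_iff:
  fixes R :: "'k::wellorder set \<Rightarrow> 'k set \<Rightarrow> bool"
  shows "proxy_P \<mu> R \<longleftrightarrow> diamond TYPE('k) \<and> (\<exists>\<C>. proxy_sequence \<mu> R \<C>)"
  by (simp add: proxy_P_def proxy_sequence_def)

lemma proxy_sequence_mono:
  assumes "proxy_sequence \<mu> R \<C>" "\<mu> \<le>o \<nu>"
  shows "proxy_sequence \<nu> R \<C>"
  using assms ordLess_ordLeq_trans unfolding proxy_sequence_def by blast

context
  fixes \<mu> :: "'m rel" and R :: "'k::wellorder set \<Rightarrow> 'k set \<Rightarrow> bool" and \<C> :: "'k \<Rightarrow> 'k set set"
  assumes \<C>: "proxy_sequence \<mu> R \<C>"
begin

lemma proxy_sequence_nonempty: "\<C> \<alpha> \<noteq> {}"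
  using \<C> unfolding proxy_sequence_def by blast

lemma proxy_sequence_card: "|\<C> \<alpha>| <o \<mu>"
  using \<C> unfolding proxy_sequence_def by blast

lemma proxy_sequence_closed: "C \<in> \<C> \<alpha> \<Longrightarrow> closed_subset {..<\<alpha>} C"
  using \<C> unfolding proxy_sequence_def by blast

lemma proxy_sequence_subset: "C \<in> \<C> \<alpha> \<Longrightarrow> C \<subseteq> {..<\<alpha>}"
  using proxy_sequence_closed by (auto simp: closed_subset_def)

lemma proxy_sequence_osup: "C \<in> \<C> \<alpha> \<Longrightarrow> limit_ord \<alpha> \<Longrightarrow> osup C = \<alpha>"
  using \<C> osup_lessThan unfolding proxy_sequence_def by metis

lemma proxy_sequence_cofinal_in:
  assumes "C \<in> \<C> \<alpha>" "limit_ord \<alpha>"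
  shows "cofinal_in C \<alpha>"
  using proxy_sequence_osup[OF assms] proxy_sequence_subset[OF assms(1)]
  by (simp add: osup_Int_lessThan_eq_iff[symmetric] Int_absorb2)

lemma proxy_sequence_coherent: "C \<in> \<C> \<alpha> \<Longrightarrow> \<beta> \<in> acc_pts C \<Longrightarrow> \<exists>D\<in>\<C> \<beta>. R D C"
  using \<C> unfolding proxy_sequence_def by blast

lemma proxy_sequence_hitting:
  assumes "cofinal_kappa B"
  shows "stationary {\<alpha>. \<forall>C\<in>\<C> \<alpha>. cofinal_in (nacc_pts C \<inter> B) \<alpha>}"
proof -
  have "osup (nacc_pts C \<inter> B) = \<alpha> \<longleftrightarrow> cofinal_in (nacc_pts C \<inter> B) \<alpha>" if "C \<in> \<C> \<alpha>" for C \<alpha>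
  proof -
    have "nacc_pts C \<inter> B \<subseteq> {..<\<alpha>}"
      using proxy_sequence_subset[OF that] by (auto simp: nacc_pts_def)
    then show ?thesis by (simp add: osup_Int_lessThan_eq_iff[symmetric] Int_absorb2)
  qed
  moreover have "stationary {\<alpha>. \<forall>C\<in>\<C> \<alpha>. osup (nacc_pts C \<inter> B) = \<alpha>}"
    using \<C> assms unfolding proxy_sequence_def by blast
  ultimately show ?thesis by (simp cong: ball_cong)
qed

end

lemma proxy_sequence_init_seg_star:
  fixes \<C> :: "'k::wellorder \<Rightarrow> 'k set set"
  assumes \<C>: "proxy_sequence \<mu> (\<sqsubseteq>\<^sub>i) \<C>"
  shows "proxy_sequence \<mu> (\<sqsubseteq>\<^sub>*) \<C>"
proof -
  have "\<exists>D\<in>\<C> \<beta>. D \<sqsubseteq>\<^sub>* C" if C: "C \<in> \<C> \<alpha>" "\<beta> \<in> acc_pts C" for \<alpha> \<beta> C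
  proof -
    obtain D where D: "D \<in> \<C> \<beta>" "D \<sqsubseteq>\<^sub>i C" using proxy_sequence_coherent[OF \<C> C] by blast
    have "osup D = \<beta>"
      using proxy_sequence_osup[OF \<C> D(1) acc_pts_limit_ord[OF C(2)]] .
    then have "ord_zero < osup D" using C(2) by (simp add: acc_pts_iff)
    then have "D \<sqsubseteq>\<^sub>* C" using D(2) by (auto simp: init_seg_star_def lessThan_ord_zero)
    then show ?thesis using D(1) by blast
  qed
  then show ?thesis using \<C> unfolding proxy_sequence_def by blast
qed

lemma proxy_sequence_eventually_coherent:
  assumes \<C>: "proxy_sequence \<mu> (\<sqsubseteq>\<^sub>*) \<C>" and C: "C \<in> \<C> \<alpha>" and \<beta>: "\<beta> \<in> acc_pts C"
  obtains D \<epsilon> where "D \<in> \<C> \<beta>" "\<epsilon> < \<beta>" "D \<inter> {\<epsilon>..} = C \<inter> {\<epsilon>..<\<beta>}"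
proof -
  obtain D where D: "D \<in> \<C> \<beta>" "D \<sqsubseteq>\<^sub>* C" using proxy_sequence_coherent[OF \<C> C \<beta>] by blast
  note limit = acc_pts_limit_ord[OF \<beta>]
  obtain \<epsilon> \<zeta> where \<epsilon>: "\<epsilon> < \<beta>" and seg: "D - {..<\<epsilon>} = (C - {..<\<epsilon>}) \<inter> {..<\<zeta>}"
    using D(2) proxy_sequence_osup[OF \<C> D(1) limit]
    unfolding init_seg_star_def init_seg_def by blast
  have "\<delta> < \<zeta>" if \<delta>: "\<epsilon> \<le> \<delta>" "\<delta> < \<beta>" for \<delta>
  proof -
    obtain \<delta>' where "\<delta>' \<in> D" "\<delta> < \<delta>'"
      using cofinal_inD[OF proxy_sequence_cofinal_in[OF \<C> D(1) limit] \<delta>(2)] by blast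
    moreover from this have "\<delta>' \<in> D - {..<\<epsilon>}" using \<delta>(1) by auto
    then have "\<delta>' < \<zeta>" unfolding seg by simp
    ultimately show ?thesis by simp
  qed
  moreover have "\<delta> \<in> D \<longleftrightarrow> \<delta> \<in> C \<and> \<delta> < \<zeta>" if "\<epsilon> \<le> \<delta>" for \<delta>
    using seg that by (auto simp: set_eq_iff not_less)
  ultimately have "D \<inter> {\<epsilon>..} = C \<inter> {\<epsilon>..<\<beta>}"
    using proxy_sequence_subset[OF \<C> D(1)] by auto
  then show thesis using D(1) \<epsilon> that by blast
qed

definition meets_cofinally :: "('k::wellorder \<Rightarrow> 'k set set) \<Rightarrow> 'k \<Rightarrow> bool" where
  "meets_cofinally \<C> \<alpha> \<longleftrightarrow> (\<forall>C\<in>\<C> \<alpha>. \<forall>D\<in>\<C> \<alpha>. cofinal_in (C \<inter> D) \<alpha>)"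

lemma ordLess_ctwo_imp_eq:
  assumes "|A| <o ctwo" "x \<in> A" "y \<in> A"
  shows "x = y"
proof (rule ccontr)
  assume "x \<noteq> y"
  then have "inj (\<lambda>b. if b then x else y)" "range (\<lambda>b. if b then x else y) \<subseteq> A"
    using assms(2,3) by (auto simp: inj_on_def)
  then have "ctwo \<le>o |A|" unfolding ctwo_def by (intro card_of_ordLeq[THEN iffD1] exI conjI)
  then show False using assms(1) not_ordLeq_ordLess by blast
qed

lemma meets_cofinally_ctwo:
  assumes \<C>: "proxy_sequence ctwo R \<C>" and "limit_ord \<alpha>"
  shows "meets_cofinally \<C> \<alpha>"
  unfolding meets_cofinally_def
proof (intro ballI)
  fix C D assume CD: "C \<in> \<C> \<alpha>" "D \<in> \<C> \<alpha>"
  then have "C = D" using ordLess_ctwo_imp_eq[OF proxy_sequence_card[OF \<C>]] by blast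
  then show "cofinal_in (C \<inter> D) \<alpha>"
    using proxy_sequence_cofinal_in[OF \<C> CD(1) assms(2)] by simp
qed

lemma (in regular_uncountable_cardinal) meets_cofinally_E_gt_omega:
  fixes \<C> :: "'k \<Rightarrow> 'k set set"
  assumes \<C>: "proxy_sequence \<mu> R \<C>" and \<alpha>: "limit_ord \<alpha>" "\<alpha> \<in> E_gt_omega"
  shows "meets_cofinally \<C> \<alpha>"
  unfolding meets_cofinally_def
proof (intro ballI)
  fix C D assume "C \<in> \<C> \<alpha>" "D \<in> \<C> \<alpha>"
  then show "cofinal_in (C \<inter> D) \<alpha>"
    using closed_subset_Int_cofinal_in[OF \<alpha>(2)] proxy_sequence_closed[OF \<C>]
      proxy_sequence_cofinal_in[OF \<C> _ \<alpha>(1)] by blast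
qed

section \<open>Trees of sequences\<close>

lemma restrict_map_eq_iff: "t |` A = s |` A \<longleftrightarrow> (\<forall>x\<in>A. t x = s x)"
  by (auto simp: fun_eq_iff restrict_map_def)

lemma map_le_iff_restrict_map: "s \<subseteq>\<^sub>m t \<longleftrightarrow> t |` dom s = s"
  unfolding map_le_def fun_eq_iff restrict_map_def by (metis domIff)

lemma restrict_map_le: "t |` A \<subseteq>\<^sub>m t"
  by (auto simp: map_le_def)

lemma restrict_map_superset: "dom t \<subseteq> A \<Longrightarrow> t |` A = t"
  unfolding fun_eq_iff restrict_map_def by (metis domIff subsetD)

lemma restrict_map_lessThan_lessThan:
  "\<beta> \<le> (\<alpha> :: 'a::linorder) \<Longrightarrow> (t |` {..<\<alpha>}) |` {..<\<beta>} = t |` {..<\<beta>}"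
  by (simp add: Int_absorb1)

lemma restrict_eq_if_cofinal_in:
  assumes cof: "cofinal_in A \<sigma>"
    and eq: "\<And>\<delta>. \<delta> \<in> A \<Longrightarrow> \<delta> < \<sigma> \<Longrightarrow> t |` {..<\<delta>} = t' |` {..<\<delta>}"
  shows "t |` {..<\<sigma>} = t' |` {..<\<sigma>}"
  unfolding restrict_map_eq_iff
proof
  fix y assume "y \<in> {..<\<sigma>}"
  then obtain \<delta> where "\<delta> \<in> A" "y < \<delta>" "\<delta> < \<sigma>" using cofinal_inD[OF cof] by auto
  then show "t y = t' y" using eq[of \<delta>] by (auto simp: restrict_map_eq_iff)
qed

lemma ex_map_glueing:
  fixes F :: "'a::wellorder \<Rightarrow> 'a \<rightharpoonup> 'b"
  assumes cof: "cofinal_in A \<sigma>"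
    and dom: "\<And>\<delta>. \<delta> \<in> A \<Longrightarrow> \<delta> < \<sigma> \<Longrightarrow> dom (F \<delta>) = {..<\<delta>}"
    and coh: "\<And>\<delta> \<delta>'. \<delta> \<in> A \<Longrightarrow> \<delta>' \<in> A \<Longrightarrow> \<delta> \<le> \<delta>' \<Longrightarrow> \<delta>' < \<sigma> \<Longrightarrow> F \<delta>' |` {..<\<delta>} = F \<delta>"
  obtains t where "dom t = {..<\<sigma>}" "\<And>\<delta>. \<delta> \<in> A \<Longrightarrow> \<delta> < \<sigma> \<Longrightarrow> t |` {..<\<delta>} = F \<delta>"
proof -
  obtain c where c: "\<And>\<beta>. \<beta> < \<sigma> \<Longrightarrow> c \<beta> \<in> A \<and> \<beta> < c \<beta> \<and> c \<beta> < \<sigma>"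
    using cof unfolding cofinal_in_def by metis
  define t where "t y = (if y < \<sigma> then F (c y) y else None)" for y
  have agree: "F \<delta> y = F \<delta>' y" if "\<delta> \<in> A" "\<delta>' \<in> A" "y < \<delta>" "\<delta> \<le> \<delta>'" "\<delta>' < \<sigma>" for \<delta> \<delta>' y
    using coh[OF that(1,2,4,5)] that(3) by (metis lessThan_iff restrict_in)
  have t: "t y = F \<delta> y" if "\<delta> \<in> A" "\<delta> < \<sigma>" "y < \<delta>" for \<delta> y
  proof -
    have y: "y < \<sigma>" using that(2,3) by simp
    then have "F (c y) y = F \<delta> y" using that c[OF y] agree by (metis linear)
    then show ?thesis using y by (simp add: t_def)
  qed
  show thesis
  proof
    have "y \<in> dom (F (c y))" if "y < \<sigma>" for y using c[OF that] dom by auto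
    then show "dom t = {..<\<sigma>}" by (force simp: t_def dom_def split: if_splits)
    show "t |` {..<\<delta>} = F \<delta>" if "\<delta> \<in> A" "\<delta> < \<sigma>" for \<delta>
    proof -
      have "t |` {..<\<delta>} = F \<delta> |` {..<\<delta>}" using t[OF that] by (simp add: restrict_map_eq_iff)
      then show ?thesis using dom[OF that] by (simp add: restrict_map_superset)
    qed
  qed
qed

definition seq_tree :: "'k::wellorder node set \<Rightarrow> bool" where
  "seq_tree T \<longleftrightarrow> T \<subseteq> (\<Union>\<alpha>. seqs \<alpha>) \<and> (\<forall>t\<in>T. \<forall>\<beta>. t |` {..<\<beta>} \<in> T)"

lemma streamlined_tree_iff:
  fixes T :: "'k::wellorder node set"
  shows "streamlined_tree T \<longleftrightarrow>
    seq_tree T \<and> (\<forall>\<alpha>. level T \<alpha> \<noteq> {} \<and> |level T \<alpha>| <o (kappa :: 'k rel))"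
  unfolding streamlined_tree_def seq_tree_def by blast

lemma dom_level: "t \<in> level T \<alpha> \<Longrightarrow> dom t = {..<\<alpha>}"
  by (simp add: level_def seqs_def)

lemma ht_level: "t \<in> level T \<alpha> \<Longrightarrow> ht t = \<alpha>"
  by (rule ht_eq[OF dom_level])

text \<open>Paths of limit length are the unions of branches; they need not be nodes.\<close>

definition path :: "'k::wellorder node set \<Rightarrow> 'k \<Rightarrow> 'k node \<Rightarrow> bool" where
  "path T \<alpha> t \<longleftrightarrow> dom t = {..<\<alpha>} \<and> (\<forall>\<beta><\<alpha>. t |` {..<\<beta>} \<in> T)"

definition restrictions :: "'k::wellorder \<Rightarrow> 'k node \<Rightarrow> 'k node set" where
  "restrictions \<alpha> t = (\<lambda>\<beta>. t |` {..<\<beta>}) ` {..<\<alpha>}"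

lemma map_le_if_restrictions_map_le:
  assumes "limit_ord \<alpha>" "dom t = {..<\<alpha>}" "\<And>s. s \<in> restrictions \<alpha> t \<Longrightarrow> s \<subseteq>\<^sub>m u"
  shows "t \<subseteq>\<^sub>m u"
  unfolding map_le_def
proof
  fix y assume y: "y \<in> dom t"
  then obtain \<beta> where "y < \<beta>" "\<beta> < \<alpha>" using assms(1,2) by (auto simp: limit_ord_def)
  then have "t |` {..<\<beta>} \<subseteq>\<^sub>m u" using assms(3) by (simp add: restrictions_def)
  then show "t y = u y" using y \<open>y < \<beta>\<close> by (simp add: map_le_def)
qed

context
  fixes T :: "'k::wellorder node set"
  assumes T: "seq_tree T"
begin

lemma seq_tree_restrict: "t \<in> T \<Longrightarrow> t |` {..<\<beta>} \<in> T"
  using T by (simp add: seq_tree_def)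

lemma mem_level_ht:
  assumes "t \<in> T"
  shows "t \<in> level T (ht t)"
proof -
  obtain \<alpha> where "t \<in> level T \<alpha>" using T assms by (auto simp: seq_tree_def level_def)
  then show ?thesis using ht_level by metis
qed

lemma dom_eq_ht: "t \<in> T \<Longrightarrow> dom t = {..<ht t}"
  using mem_level_ht by (rule dom_level)

lemma mem_level_iff: "t \<in> level T \<alpha> \<longleftrightarrow> t \<in> T \<and> dom t = {..<\<alpha>}"
  using mem_level_ht dom_level ht_eq by (metis IntD1 level_def)

lemma level_restrict: "t \<in> level T \<alpha> \<Longrightarrow> \<beta> \<le> \<alpha> \<Longrightarrow> t |` {..<\<beta>} \<in> level T \<beta>"
  using seq_tree_restrict by (auto simp: mem_level_iff)

lemma level_path: "t \<in> level T \<alpha> \<Longrightarrow> path T \<alpha> t"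
  using seq_tree_restrict by (simp add: path_def mem_level_iff)

lemma path_restrict_level: "path T \<alpha> t \<Longrightarrow> \<beta> < \<alpha> \<Longrightarrow> t |` {..<\<beta>} \<in> level T \<beta>"
  by (auto simp: path_def mem_level_iff)

lemma path_if_cofinal_in:
  assumes cof: "cofinal_in A \<sigma>" and dom: "dom t = {..<\<sigma>}"
    and nodes: "\<And>\<delta>. \<delta> \<in> A \<Longrightarrow> \<delta> < \<sigma> \<Longrightarrow> t |` {..<\<delta>} \<in> T"
  shows "path T \<sigma> t"
proof -
  have "t |` {..<\<beta>} \<in> T" if "\<beta> < \<sigma>" for \<beta>
  proof -
    obtain \<delta> where "\<delta> \<in> A" "\<beta> < \<delta>" "\<delta> < \<sigma>" using cofinal_inD[OF cof \<open>\<beta> < \<sigma>\<close>] by blast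
    then show ?thesis
      using seq_tree_restrict[OF nodes] by (metis less_imp_le restrict_map_lessThan_lessThan)
  qed
  with dom show ?thesis by (simp add: path_def)
qed

lemma map_le_restrict_ht: "s \<in> T \<Longrightarrow> s \<subseteq>\<^sub>m t \<longleftrightarrow> t |` {..<ht s} = s"
  by (simp add: map_le_iff_restrict_map dom_eq_ht)

lemma below_ht_less:
  assumes "s \<in> T" "t \<in> T" "s \<subset>\<^sub>m t"
  shows "ht s < ht t"
proof (rule ccontr)
  assume "\<not> ht s < ht t"
  then have "t |` {..<ht s} = t" using dom_eq_ht[OF assms(2)] by (simp add: restrict_map_superset)
  then show False using assms(1,3) by (metis below_def map_le_restrict_ht)
qed

lemma branch_map_le:
  assumes B: "branch T X B" and st: "s \<in> B" "t \<in> B" "ht s \<le> ht t"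
  shows "s \<subseteq>\<^sub>m t"
proof -
  have T: "s \<in> T" "t \<in> T" using B st by (auto simp: branch_def)
  have "s \<subset>\<^sub>m t \<or> s = t \<or> t \<subset>\<^sub>m s" using B st(1,2) by (simp add: branch_def)
  then show ?thesis using below_ht_less[OF T(2,1)] st(3) by (auto simp: below_def)
qed

lemma branch_restrictions:
  assumes "path T \<alpha> t"
  shows "branch T {..<\<alpha>} (restrictions \<alpha> t)"
  unfolding branch_def
proof (intro conjI ballI)
  show "restrictions \<alpha> t \<subseteq> T" using assms by (auto simp: path_def restrictions_def)
  have "ht (t |` {..<\<beta>}) = \<beta>" if "\<beta> < \<alpha>" for \<beta>
    using path_restrict_level[OF assms that] by (rule ht_level)
  then show "ht ` restrictions \<alpha> t = {..<\<alpha>}" by (force simp: restrictions_def image_image)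
  fix u v assume "u \<in> restrictions \<alpha> t" "v \<in> restrictions \<alpha> t"
  then obtain \<beta> \<beta>' where "u = t |` {..<\<beta>}" "v = t |` {..<\<beta>'}" by (auto simp: restrictions_def)
  then have "u \<subseteq>\<^sub>m v \<or> v \<subseteq>\<^sub>m u"
    by (cases "\<beta> \<le> \<beta>'") (auto simp: map_le_def restrict_map_def)
  then show "u \<subset>\<^sub>m v \<or> u = v \<or> v \<subset>\<^sub>m u" by (auto simp: below_def)
qed

lemma vanishing_restrictions_iff:
  assumes "limit_ord \<alpha>" and path: "path T \<alpha> t"
  shows "vanishing T (restrictions \<alpha> t) \<longleftrightarrow> t \<notin> T"
proof
  show "t \<notin> T" if "vanishing T (restrictions \<alpha> t)"
    using that restrict_map_le by (auto simp: vanishing_def restrictions_def)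
  show "vanishing T (restrictions \<alpha> t)" if t: "t \<notin> T"
    unfolding vanishing_def
  proof
    assume "\<exists>u\<in>T. \<forall>s\<in>restrictions \<alpha> t. s \<subseteq>\<^sub>m u"
    then obtain u where u: "u \<in> T" "\<And>s. s \<in> restrictions \<alpha> t \<Longrightarrow> s \<subseteq>\<^sub>m u" by blast
    have dom: "dom t = {..<\<alpha>}" using path by (simp add: path_def)
    then have "t \<subseteq>\<^sub>m u" using assms(1) u(2) by (blast intro: map_le_if_restrictions_map_le)
    then have "u |` {..<\<alpha>} = t" using dom by (simp add: map_le_iff_restrict_map)
    then show False using seq_tree_restrict[OF u(1)] t by metis
  qed
qed

lemma branch_eq_restrictions:
  assumes \<alpha>: "limit_ord \<alpha>" and B: "branch T {..<\<alpha>} B"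
  obtains t where "path T \<alpha> t" "B = restrictions \<alpha> t"
proof -
  have sub: "B \<subseteq> T" and ht: "ht ` B = {..<\<alpha>}" using B by (simp_all add: branch_def)
  note chain = branch_map_le[OF B]
  have "\<exists>s\<in>B. ht s = \<beta>" if "\<beta> < \<alpha>" for \<beta> using ht that by (metis image_iff lessThan_iff)
  then obtain b where b: "\<And>\<beta>. \<beta> < \<alpha> \<Longrightarrow> b \<beta> \<in> B \<and> ht (b \<beta>) = \<beta>" by metis
  have b_unique: "b (ht s) = s" if "s \<in> B" for s
  proof -
    have "ht s < \<alpha>" using that ht by blast
    then show ?thesis using b chain that by (metis map_le_antisym order_refl)
  qed
  obtain t where t: "dom t = {..<\<alpha>}" "\<And>\<beta>. \<beta> < \<alpha> \<Longrightarrow> t |` {..<\<beta>} = b \<beta>"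
  proof (rule ex_map_glueing[OF cofinal_in_UNIV_if_limit_ord[OF \<alpha>], of b])
    show "dom (b \<beta>) = {..<\<beta>}" if "\<beta> < \<alpha>" for \<beta> using b[OF that] dom_eq_ht[of "b \<beta>"] sub by auto
    show "b \<beta>' |` {..<\<beta>} = b \<beta>" if "\<beta> \<le> \<beta>'" "\<beta>' < \<alpha>" for \<beta> \<beta>'
    proof -
      have "b \<beta> \<in> B" "ht (b \<beta>) = \<beta>" "b \<beta>' \<in> B" "ht (b \<beta>') = \<beta>'" using b that by auto
      then show ?thesis using chain[of "b \<beta>" "b \<beta>'"] map_le_restrict_ht[of "b \<beta>"] sub that by auto
    qed
  qed (use that in auto)
  have "restrictions \<alpha> t = b ` {..<\<alpha>}" using t(2) by (simp add: restrictions_def)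
  also have "\<dots> = (b \<circ> ht) ` B" by (simp only: image_comp[symmetric] ht)
  also have "\<dots> = B" using b_unique by simp
  finally have "B = restrictions \<alpha> t" ..
  moreover have "path T \<alpha> t" using t b sub by (auto simp: path_def)
  ultimately show thesis using that by blast
qed

lemma vanishing_branch_iff:
  assumes "limit_ord \<alpha>"
  shows "branch T {..<\<alpha>} B \<and> vanishing T B \<longleftrightarrow> (\<exists>t. path T \<alpha> t \<and> t \<notin> T \<and> B = restrictions \<alpha> t)"
proof
  assume B: "branch T {..<\<alpha>} B \<and> vanishing T B"
  then obtain t where "path T \<alpha> t" "B = restrictions \<alpha> t"
    using branch_eq_restrictions[OF assms] by blast
  then show "\<exists>t. path T \<alpha> t \<and> t \<notin> T \<and> B = restrictions \<alpha> t"
    using vanishing_restrictions_iff[OF assms] B by blast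
qed (use branch_restrictions vanishing_restrictions_iff[OF assms] in blast)

lemma V_minus_iff: "\<alpha> \<in> V_minus T \<longleftrightarrow> limit_ord \<alpha> \<and> (\<exists>t. path T \<alpha> t \<and> t \<notin> T)"
  using vanishing_branch_iff[of \<alpha>] by (auto simp: V_minus_def)

lemma mem_restrictions_iff:
  assumes "s \<in> T" "ht s < \<alpha>"
  shows "s \<in> restrictions \<alpha> t \<longleftrightarrow> s \<subseteq>\<^sub>m t"
proof
  show "s \<subseteq>\<^sub>m t" if "s \<in> restrictions \<alpha> t"
    using that restrict_map_le by (auto simp: restrictions_def)
  show "s \<in> restrictions \<alpha> t" if "s \<subseteq>\<^sub>m t"
    unfolding restrictions_def
    by (rule image_eqI[of _ _ "ht s"]) (use that assms map_le_restrict_ht in auto)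
qed

lemma V_full_iff:
  "\<alpha> \<in> V_full T \<longleftrightarrow>
    limit_ord \<alpha> \<and> (\<forall>s\<in>T. ht s < \<alpha> \<longrightarrow> (\<exists>t. path T \<alpha> t \<and> t \<notin> T \<and> s \<subseteq>\<^sub>m t))"
proof (cases "limit_ord \<alpha>")
  case True
  have "(\<exists>B. branch T {..<\<alpha>} B \<and> vanishing T B \<and> s \<in> B) \<longleftrightarrow>
      (\<exists>t. path T \<alpha> t \<and> t \<notin> T \<and> s \<subseteq>\<^sub>m t)" if "s \<in> T" "ht s < \<alpha>" for s
    using vanishing_branch_iff[OF True] mem_restrictions_iff[OF that] by blast
  then show ?thesis by (simp add: V_full_def)
qed (simp add: V_full_def)

end

section \<open>Souslin trees from sealed dense sets\<close>

definition dense_in :: "'k::wellorder node set \<Rightarrow> 'k node set \<Rightarrow> bool" where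
  "dense_in T D \<longleftrightarrow> D \<subseteq> T \<and> (\<forall>t\<in>T. \<exists>d\<in>D. t \<subseteq>\<^sub>m d)"

definition sealed_at :: "'k::wellorder node set \<Rightarrow> 'k node set \<Rightarrow> 'k \<Rightarrow> bool" where
  "sealed_at T D \<alpha> \<longleftrightarrow> (\<forall>t\<in>level T \<alpha>. \<exists>d\<in>D. d \<subseteq>\<^sub>m t)"

lemma dense_in_Diff_branch:
  assumes T: "seq_tree T" "splitting_tree T" and B: "branch T X B"
  shows "dense_in T (T - B)"
  unfolding dense_in_def
proof (intro conjI ballI)
  fix s assume "s \<in> T"
  then obtain t u where tu: "t \<in> imm_succs T s" "u \<in> imm_succs T s" "t \<noteq> u"
    using T(2) by (auto simp: splitting_tree_def)
  then have "\<not> t \<subset>\<^sub>m u" "\<not> u \<subset>\<^sub>m t" by (auto simp: imm_succs_def)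
  then have "\<not> (t \<in> B \<and> u \<in> B)" using B tu(3) by (auto simp: branch_def)
  then show "\<exists>d\<in>T - B. s \<subseteq>\<^sub>m d" using tu by (auto simp: imm_succs_def below_def)
qed blast

lemma no_kappa_branch_if_sealed:
  assumes T: "seq_tree T" "splitting_tree T"
    and sealed: "\<And>D. dense_in T D \<Longrightarrow> \<exists>\<alpha>. sealed_at T D \<alpha>"
  shows "\<not> branch T UNIV B"
proof
  assume B: "branch T UNIV B"
  then have sub: "B \<subseteq> T" and ht: "ht ` B = UNIV" by (simp_all add: branch_def)
  have ex: "\<exists>b\<in>B. ht b = \<beta>" for \<beta> using ht by (metis UNIV_I image_iff)
  obtain \<alpha> where \<alpha>: "sealed_at T (T - B) \<alpha>" using sealed[OF dense_in_Diff_branch[OF T B]] ..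
  obtain b where b: "b \<in> B" "ht b = \<alpha>" using ex by blast
  then have "b \<in> level T \<alpha>" using mem_level_ht[OF T(1)] sub by blast
  then obtain d where d: "d \<in> T" "d \<notin> B" "d \<subseteq>\<^sub>m b" using \<alpha> by (auto simp: sealed_at_def)
  obtain b' where b': "b' \<in> B" "ht b' = ht d" using ex by blast
  have "ht d \<le> ht b"
    using d b(1) sub below_ht_less[OF T(1), of d b] by (cases "d = b") (auto simp: below_def)
  then have "b |` {..<ht b'} = b'"
    using branch_map_le[OF T(1) B b'(1) b(1)] map_le_restrict_ht[OF T(1)] b' sub by auto
  then have "b' = d" using map_le_restrict_ht[OF T(1) d(1)] d(3) b'(2) by simp
  then show False using b'(1) d(2) by blast
qed

text \<open>
  The nodes that extend an element of an antichain \<open>A\<close> or are incompatible with all of \<open>A\<close> are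
  dense, so that \<open>A\<close> does not reach beyond the level at which this dense set is sealed.
\<close>

lemma antichain_bounded_if_sealed:
  assumes T: "seq_tree T" and A: "antichain T A"
    and sealed: "\<And>D. dense_in T D \<Longrightarrow> \<exists>\<alpha>. sealed_at T D \<alpha>"
  obtains \<alpha> where "\<And>a. a \<in> A \<Longrightarrow> ht a \<le> \<alpha>"
proof -
  define D where "D = {t\<in>T. (\<exists>a\<in>A. a \<subseteq>\<^sub>m t) \<or> \<not> (\<exists>u\<in>T. t \<subseteq>\<^sub>m u \<and> (\<exists>a\<in>A. a \<subseteq>\<^sub>m u))}"
  have "dense_in T D"
    unfolding dense_in_def D_def using map_le_refl by blast
  then obtain \<alpha> where \<alpha>: "sealed_at T D \<alpha>" using sealed by blast
  have "ht a \<le> \<alpha>" if a: "a \<in> A" for a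
  proof (rule ccontr)
    assume "\<not> ht a \<le> \<alpha>"
    then have "\<alpha> < ht a" by simp
    have "a \<in> T" using A a by (auto simp: antichain_def)
    then have "a |` {..<\<alpha>} \<in> level T \<alpha>"
      using level_restrict[OF T mem_level_ht[OF T]] \<open>\<alpha> < ht a\<close> by simp
    then obtain d where d: "d \<in> D" "d \<subseteq>\<^sub>m a |` {..<\<alpha>}" using \<alpha> by (auto simp: sealed_at_def)
    then have "d \<subseteq>\<^sub>m a" using restrict_map_le map_le_trans by blast
    then obtain a' where a': "a' \<in> A" "a' \<subseteq>\<^sub>m d"
      using d(1) a \<open>a \<in> T\<close> map_le_refl unfolding D_def by blast
    have "dom a' \<subseteq> {..<\<alpha>}"
      using map_le_implies_dom_le[OF map_le_trans[OF a'(2) d(2)]] by simp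
    moreover have "\<alpha> \<in> dom a" using dom_eq_ht[OF T \<open>a \<in> T\<close>] \<open>\<alpha> < ht a\<close> by simp
    ultimately have "a' \<noteq> a" by auto
    moreover have "a' \<subseteq>\<^sub>m a" using a'(2) \<open>d \<subseteq>\<^sub>m a\<close> by (rule map_le_trans)
    ultimately show False using A a a'(1) by (auto simp: antichain_def below_def)
  qed
  then show thesis by (rule that)
qed

lemma (in regular_cardinal) souslin_tree_if_sealed:
  fixes T :: "'k node set"
  assumes T: "streamlined_tree T" "splitting_tree T"
    and sealed: "\<And>D. dense_in T D \<Longrightarrow> \<exists>\<alpha>. sealed_at T D \<alpha>"
  shows "souslin_tree T"
proof -
  have seq: "seq_tree T" and small: "|level T \<alpha>| <o \<kappa>" for \<alpha>
    using T(1) by (auto simp: streamlined_tree_iff)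
  have "|A| <o \<kappa>" if A: "antichain T A" for A
  proof -
    obtain \<alpha> where \<alpha>: "\<And>a. a \<in> A \<Longrightarrow> ht a \<le> \<alpha>"
      using antichain_bounded_if_sealed[OF seq A sealed] by blast
    have "A \<subseteq> (\<Union>\<beta>\<in>{..<osuc \<alpha>}. level T \<beta>)"
    proof
      fix a assume "a \<in> A"
      then have "a \<in> level T (ht a)" using mem_level_ht[OF seq] A by (auto simp: antichain_def)
      then show "a \<in> (\<Union>\<beta>\<in>{..<osuc \<alpha>}. level T \<beta>)"
        using \<alpha>[OF \<open>a \<in> A\<close>] by (auto simp: less_osuc_iff)
    qed
    then show ?thesis by (rule small_mono) (intro small_UN small_lessThan small)
  qed
  then show ?thesis
    unfolding souslin_tree_def
    using T(1) no_kappa_branch_if_sealed[OF seq T(2) sealed] not_ordLess_ordIso by blast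
qed

section \<open>Coding of nodes by ordinals\<close>

function von_neumann :: "'k::wellorder \<Rightarrow> 'k hset" where
  "von_neumann \<alpha> = (SOME x. \<forall>z. hmem z x \<longleftrightarrow> z \<in> von_neumann ` {..<\<alpha>})"
  by pat_completeness auto
termination by (relation "{(x, y). x < y}") (auto simp: wf)

declare von_neumann.simps [simp del]

lemma hmem_von_neumann: "hmem z (von_neumann \<alpha>) \<longleftrightarrow> z \<in> von_neumann ` {..<\<alpha>}"
proof -
  have "|von_neumann ` {..<\<alpha>}| \<le>o |UNIV :: 'a set|"
    by (rule ordLeq_transitive[OF card_of_image card_of_mono1]) simp
  then have "\<exists>x. \<forall>z. hmem z x \<longleftrightarrow> z \<in> von_neumann ` {..<\<alpha>}"
    by (rule hset_comprehension)
  from someI_ex[OF this] show ?thesis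
    unfolding von_neumann.simps[of \<alpha>] by blast
qed

lemma inj_von_neumann: "inj von_neumann"
proof (rule linorder_injI)
  fix \<alpha> \<beta> :: "'a::wellorder"
  assume "\<alpha> < \<beta>"
  then have "hmem (von_neumann \<alpha>) (von_neumann \<beta>)" by (simp add: hmem_von_neumann)
  then show "von_neumann \<alpha> \<noteq> von_neumann \<beta>"
    using wfp_imp_irreflp[OF hset_wf] by (metis irreflpD)
qed

lemma trcl_von_neumann: "trcl (von_neumann \<alpha>) \<subseteq> von_neumann ` {..<\<alpha>}"
proof -
  have "y \<in> von_neumann ` {..<\<alpha>}" if "hmem\<^sup>+\<^sup>+ y x" "x = von_neumann \<alpha>" for x y
    using that
  proof (induction rule: converse_tranclp_induct)
    case (base y)
    then show ?case by (simp add: hmem_von_neumann)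
  next
    case (step y z)
    then obtain \<beta> where "z = von_neumann \<beta>" "\<beta> < \<alpha>" by auto
    with step show ?case by (auto simp: hmem_von_neumann)
  qed
  then show ?thesis by (auto simp: trcl_def)
qed

definition coded_nodes :: "'k::wellorder node set" where
  "coded_nodes = {t. (\<exists>\<alpha>. dom t = {..<\<alpha>}) \<and> ran t \<subseteq> range von_neumann}"

lemma coded_nodesE:
  assumes "t \<in> coded_nodes"
  obtains f \<alpha> where "t = map_option von_neumann \<circ> f" "dom f = {..<\<alpha>}"
proof -
  obtain \<alpha> where \<alpha>: "dom t = {..<\<alpha>}" using assms by (auto simp: coded_nodes_def)
  define f where "f = map_option (inv von_neumann) \<circ> t"
  have "t x = (map_option von_neumann \<circ> f) x" for x
    using assms ranI[of t x]
    by (cases "t x") (auto simp: f_def coded_nodes_def inv_f_f[OF inj_von_neumann])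
  then have "t = map_option von_neumann \<circ> f" ..
  moreover have "dom f = {..<\<alpha>}" using \<alpha> by (simp add: f_def)
  ultimately show thesis by (rule that)
qed

lemma (in regular_cardinal) von_neumann_H_kappa: "von_neumann (\<alpha>::'k) \<in> H_kappa"
  using small_mono[OF trcl_von_neumann small_image[OF small_lessThan]]
  by (simp add: H_kappa_def)

lemma (in regular_cardinal) ex_inj_pairs: "\<exists>p :: 'k \<times> 'k \<Rightarrow> 'k. inj p"
proof -
  have "|UNIV \<times> UNIV :: ('k \<times> 'k) set| \<le>o |UNIV :: 'k set|"
    using card_of_Times_same_infinite[OF infinite_UNIV_kappa] ordIso_iff_ordLeq by blast
  then show ?thesis using card_of_ordLeq[of "UNIV \<times> UNIV" UNIV] by (metis UNIV_Times_UNIV)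
qed

lemma inj_graph: "inj Map.graph"
  by (rule injI, rule ext) (metis in_graphD in_graphI not_None_eq)

definition diamond_sequence :: "('k::wellorder \<Rightarrow> 'k set) \<Rightarrow> bool" where
  "diamond_sequence S \<longleftrightarrow> (\<forall>A. stationary {\<alpha>. A \<inter> {..<\<alpha>} = S \<alpha>})"

lemma diamond_imp_ex_diamond_sequence:
  "diamond TYPE('k::wellorder) \<Longrightarrow> \<exists>S :: 'k \<Rightarrow> 'k set. diamond_sequence S"
  unfolding diamond_def diamond_sequence_def by blast

context regular_uncountable_cardinal
begin

lemma diamond_sequence_closure_point:
  fixes f :: "'k \<Rightarrow> 'k"
  assumes "diamond_sequence S"
  obtains \<beta> where "A \<inter> {..<\<beta>} = S \<beta>" "\<alpha> < \<beta>" "limit_ord \<beta>" "\<And>\<gamma>. \<gamma> < \<beta> \<Longrightarrow> f \<gamma> < \<beta>"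
proof -
  have "stationary {\<alpha>. A \<inter> {..<\<alpha>} = S \<alpha>}" using assms by (simp add: diamond_sequence_def)
  then obtain \<beta> where "\<beta> \<in> {\<alpha>. A \<inter> {..<\<alpha>} = S \<alpha>}" "\<alpha> < \<beta>" "limit_ord \<beta>"
    "\<And>\<gamma>. \<gamma> < \<beta> \<Longrightarrow> f \<gamma> < \<beta>"
    by (rule stationary_closure_point[of _ \<alpha> f]) blast
  then show thesis by (intro that) simp_all
qed

lemma diamond_enumerates_small:
  fixes A :: "'k set"
  assumes S: "diamond_sequence S" and A: "|A| <o \<kappa>"
  obtains \<alpha> where "S \<alpha> = A"
proof -
  obtain \<beta> where "A \<subseteq> {..<\<beta>}" by (rule small_bounded[OF A])
  moreover obtain \<alpha> where "A \<inter> {..<\<alpha>} = S \<alpha>" "\<beta> < \<alpha>"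
    by (rule diamond_sequence_closure_point[OF S, of A \<beta> id]) blast
  ultimately have "A \<subseteq> {..<\<alpha>}" by auto
  then show thesis using \<open>A \<inter> {..<\<alpha>} = S \<alpha>\<close> by (intro that[of \<alpha>]) (simp add: Int_absorb2)
qed

lemma diamond_enumerates_maps:
  fixes S :: "'k \<Rightarrow> 'k set"
  assumes S: "diamond_sequence S"
  shows "\<exists>code :: ('k \<rightharpoonup> 'k) \<Rightarrow> 'k. inj_on code {f. |dom f| <o \<kappa>}"
proof -
  obtain p :: "'k \<times> 'k \<Rightarrow> 'k" where p: "inj p" using ex_inj_pairs ..
  have "\<exists>\<alpha>. S \<alpha> = p ` Map.graph f" if "|dom f| <o \<kappa>" for f
    using diamond_enumerates_small[OF S small_image] small_image[OF that]
    unfolding graph_eq_to_snd_dom by metis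
  then obtain code where code: "\<And>f. |dom f| <o \<kappa> \<Longrightarrow> S (code f) = p ` Map.graph f" by metis
  have "inj_on code {f. |dom f| <o \<kappa>}"
  proof (rule inj_onI)
    fix f f' assume f: "f \<in> {f. |dom f| <o \<kappa>}" "f' \<in> {f. |dom f| <o \<kappa>}" "code f = code f'"
    then have "p ` Map.graph f = p ` Map.graph f'" using code by (metis mem_Collect_eq)
    then show "f = f'" using p inj_graph by (metis injD inj_image_eq_iff)
  qed
  then show ?thesis by blast
qed

lemma diamond_enumerates_coded_nodes:
  fixes S :: "'k \<Rightarrow> 'k set"
  assumes S: "diamond_sequence S"
  shows "\<exists>code :: 'k node \<Rightarrow> 'k. inj_on code coded_nodes"
proof -
  have "|{f :: 'k \<rightharpoonup> 'k. |dom f| <o \<kappa>}| \<le>o |UNIV :: 'k set|"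
    using diamond_enumerates_maps[OF S] card_of_ordLeq by (metis top_greatest)
  moreover have "coded_nodes \<subseteq> (\<circ>) (map_option von_neumann) ` {f :: 'k \<rightharpoonup> 'k. |dom f| <o \<kappa>}"
    using small_lessThan by (force elim: coded_nodesE)
  ultimately have "|coded_nodes :: 'k node set| \<le>o |UNIV :: 'k set|"
    by (meson surj_imp_ordLeq ordLeq_transitive)
  then show ?thesis using card_of_ordLeq[of "coded_nodes :: 'k node set" "UNIV :: 'k set"] by auto
qed

end

section \<open>Climbing along a closed set\<close>

definition climbs ::
    "'k::wellorder set \<Rightarrow> ('k \<Rightarrow> 'b) \<Rightarrow> ('k \<Rightarrow> ('k \<rightharpoonup> 'b) \<Rightarrow> ('k \<rightharpoonup> 'b)) \<Rightarrow> 'k \<Rightarrow> 'k \<Rightarrow> ('k \<rightharpoonup> 'b) \<Rightarrow> bool"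
  where
  "climbs C c F \<gamma> \<beta> t \<longleftrightarrow>
     (\<forall>\<delta>\<in>C. \<gamma> \<le> \<delta> \<longrightarrow> \<delta> < \<beta> \<longrightarrow> t \<delta> = Some (c \<delta>)) \<and>
     (\<forall>\<delta> \<delta>'. consecutive C \<delta> \<delta>' \<longrightarrow> \<gamma> \<le> \<delta> \<longrightarrow> \<delta>' \<le> \<beta> \<longrightarrow> t |` {..<\<delta>'} = F \<delta>' (t |` {..\<delta>}))"

lemma climbs_cong [fundef_cong]:
  assumes "C = C'" "c = c'" "\<And>\<delta> s. \<delta> \<in> C' \<Longrightarrow> F \<delta> s = F' \<delta> s" "\<gamma> = \<gamma>'" "\<beta> = \<beta>'" "t = t'"
  shows "climbs C c F \<gamma> \<beta> t \<longleftrightarrow> climbs C' c' F' \<gamma>' \<beta>' t'"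
  unfolding climbs_def consecutive_def assms(1,2,4-6) using assms(3) by auto

lemma climbs_label: "climbs C c F \<gamma> \<beta> t \<Longrightarrow> \<delta> \<in> C \<Longrightarrow> \<gamma> \<le> \<delta> \<Longrightarrow> \<delta> < \<beta> \<Longrightarrow> t \<delta> = Some (c \<delta>)"
  by (simp add: climbs_def)

lemma climbs_step:
  "climbs C c F \<gamma> \<beta> t \<Longrightarrow> consecutive C \<delta> \<delta>' \<Longrightarrow> \<gamma> \<le> \<delta> \<Longrightarrow> \<delta>' \<le> \<beta> \<Longrightarrow>
    t |` {..<\<delta>'} = F \<delta>' (t |` {..\<delta>})"
  by (simp add: climbs_def)

lemma climbs_start: "climbs C c F \<gamma> \<gamma> t"
  by (auto simp: climbs_def consecutive_def)

lemma climbs_mono: "climbs C c F \<gamma> \<beta> t \<Longrightarrow> \<beta>' \<le> \<beta> \<Longrightarrow> climbs C c F \<gamma> \<beta>' t"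
  unfolding climbs_def by (meson order.trans order.strict_trans2)

lemma climbs_restrict: "climbs C c F \<gamma> \<beta> (t |` {..<\<beta>}) \<longleftrightarrow> climbs C c F \<gamma> \<beta> t"
proof -
  have "{..<\<beta>} \<inter> {..<\<delta>'} = {..<\<delta>'}" "{..<\<beta>} \<inter> {..\<delta>} = {..\<delta>}"
    if "consecutive C \<delta> \<delta>'" "\<delta>' \<le> \<beta>" for \<delta> \<delta>'
    using that by (auto simp: consecutive_def)
  then show ?thesis by (auto simp: climbs_def)
qed

lemma climbs_consecutive:
  assumes t: "climbs C c F \<gamma> \<delta> t" and con: "consecutive C \<delta> \<delta>'"
    and "t \<delta> = Some (c \<delta>)" and "t |` {..<\<delta>'} = F \<delta>' (t |` {..\<delta>})"
  shows "climbs C c F \<gamma> \<delta>' t"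
  unfolding climbs_def
proof (intro conjI ballI allI impI)
  fix \<beta> assume "\<beta> \<in> C" "\<gamma> \<le> \<beta>" "\<beta> < \<delta>'"
  moreover from this have "\<beta> \<le> \<delta>" using con by (simp add: consecutive_def)
  ultimately show "t \<beta> = Some (c \<beta>)"
    using assms(3) climbs_label[OF t] by (cases "\<beta> = \<delta>") auto
next
  fix \<beta> \<beta>' assume \<beta>: "consecutive C \<beta> \<beta>'" "\<gamma> \<le> \<beta>" "\<beta>' \<le> \<delta>'"
  show "t |` {..<\<beta>'} = F \<beta>' (t |` {..\<beta>})"
  proof (cases "\<beta>' = \<delta>'")
    case True
    then have "\<beta> = \<delta>" using \<beta>(1) con by (auto simp: consecutive_def intro: antisym)
    then show ?thesis using True assms(4) by simp
  next
    case False
    then have "\<beta>' \<le> \<delta>" using \<beta> con by (auto simp: consecutive_def)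
    then show ?thesis using climbs_step[OF t] \<beta> by blast
  qed
qed

lemma climbs_limit:
  assumes cof: "cofinal_in C \<sigma>"
    and t: "\<And>\<delta>. \<delta> \<in> C \<Longrightarrow> \<gamma> \<le> \<delta> \<Longrightarrow> \<delta> < \<sigma> \<Longrightarrow> climbs C c F \<gamma> \<delta> t"
  shows "climbs C c F \<gamma> \<sigma> t"
  unfolding climbs_def
proof (intro conjI ballI allI impI)
  fix \<delta> assume "\<delta> \<in> C" "\<gamma> \<le> \<delta>" "\<delta> < \<sigma>"
  moreover from this obtain \<delta>' where "\<delta>' \<in> C" "\<delta> < \<delta>'" "\<delta>' < \<sigma>"
    using cofinal_inD[OF cof] by blast
  ultimately show "t \<delta> = Some (c \<delta>)" using climbs_label[OF t, of \<delta>' \<delta>] by simp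
next
  fix \<delta> \<delta>' assume \<delta>: "consecutive C \<delta> \<delta>'" "\<gamma> \<le> \<delta>" "\<delta>' \<le> \<sigma>"
  have "\<delta>' \<noteq> \<sigma>" using \<delta>(1) cofinal_inD[OF cof] unfolding consecutive_def by (meson leD)
  then have "climbs C c F \<gamma> \<delta>' t" using \<delta> by (intro t) (auto simp: consecutive_def)
  then show "t |` {..<\<delta>'} = F \<delta>' (t |` {..\<delta>})" using \<delta> by (simp add: climbs_step)
qed

lemma climbs_unique:
  assumes C: "closed_subset {..<\<alpha>} C" and \<gamma>: "\<gamma> \<in> C"
    and t: "climbs C c F \<gamma> \<beta> t" "climbs C c F \<gamma> \<beta> t'"
    and eq: "t |` {..<\<gamma>} = t' |` {..<\<gamma>}"
    and \<delta>: "\<delta> \<in> C" "\<gamma> \<le> \<delta>" "\<delta> \<le> \<beta>"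
  shows "t |` {..<\<delta>} = t' |` {..<\<delta>}"
proof -
  have "\<delta> \<le> \<beta> \<longrightarrow> t |` {..<\<delta>} = t' |` {..<\<delta>}"
    using C \<gamma> \<delta>(1,2)
  proof (induction \<delta> rule: closed_subset_induct)
    case base
    then show ?case using eq by simp
  next
    case (succ \<delta> \<delta>')
    show ?case
    proof
      assume "\<delta>' \<le> \<beta>"
      moreover have "\<delta> \<in> C" "\<delta> < \<delta>'" using succ.hyps(1) by (simp_all add: consecutive_def)
      ultimately have "t \<delta> = t' \<delta>" "t |` {..<\<delta>} = t' |` {..<\<delta>}"
        using t succ by (simp_all add: climbs_label)
      then have "t |` {..\<delta>} = t' |` {..\<delta>}" by (auto simp: restrict_map_eq_iff order_le_less)
      then show "t |` {..<\<delta>'} = t' |` {..<\<delta>'}"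
        using climbs_step[OF t(1)] climbs_step[OF t(2)] succ.hyps \<open>\<delta>' \<le> \<beta>\<close> by metis
    qed
  next
    case (limit \<delta>)
    have "cofinal_in (C \<inter> {\<gamma>..}) \<delta>"
      using limit.hyps by (intro cofinal_in_Int_atLeast) (auto simp: acc_pts_iff)
    then show ?case by (intro impI) (erule restrict_eq_if_cofinal_in, use limit.IH in auto)
  qed
  then show ?thesis using \<delta>(3) by simp
qed

lemma climbs_unique_limit:
  assumes C: "closed_subset {..<\<alpha>} C" "cofinal_in C \<alpha>" and \<gamma>: "\<gamma> \<in> C"
    and t: "climbs C c F \<gamma> \<alpha> t" "climbs C c F \<gamma> \<alpha> t'" "dom t = {..<\<alpha>}" "dom t' = {..<\<alpha>}"
    and eq: "t |` {..<\<gamma>} = t' |` {..<\<gamma>}"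
  shows "t = t'"
proof -
  have "cofinal_in (C \<inter> {\<gamma>..}) \<alpha>"
    using C \<gamma> by (intro cofinal_in_Int_atLeast) (auto simp: closed_subset_def)
  then have "t |` {..<\<alpha>} = t' |` {..<\<alpha>}"
    by (rule restrict_eq_if_cofinal_in) (use climbs_unique[OF C(1) \<gamma> t(1,2) eq] in auto)
  then show ?thesis using t(3,4) by (simp add: restrict_map_superset)
qed

lemma climbs_eventually_eq:
  assumes t: "climbs C c F \<gamma> \<beta> t" and "\<gamma> \<le> \<gamma>'"
    and D: "D \<inter> {\<gamma>'..} = C \<inter> {\<gamma>'..<\<beta>}" and c: "\<And>\<delta>. \<delta> < \<beta> \<Longrightarrow> c' \<delta> = c \<delta>"
  shows "climbs D c' F \<gamma>' \<beta> t"
proof -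
  have mem: "\<delta> \<in> D \<longleftrightarrow> \<delta> \<in> C \<and> \<delta> < \<beta>" if "\<gamma>' \<le> \<delta>" for \<delta>
    using D that by (auto simp: set_eq_iff)
  have "consecutive C \<delta> \<delta>'" if "consecutive D \<delta> \<delta>'" "\<gamma>' \<le> \<delta>" for \<delta> \<delta>'
  proof -
    have "\<delta> \<in> C" "\<delta>' \<in> C" "\<delta>' < \<beta>" "\<delta> < \<delta>'"
      using that mem[of \<delta>] mem[of \<delta>'] by (auto simp: consecutive_def)
    moreover have "\<eta> \<le> \<delta>" if "\<eta> \<in> C" "\<eta> < \<delta>'" for \<eta>
    proof (rule ccontr)
      assume "\<not> \<eta> \<le> \<delta>"
      then have "\<eta> \<in> D"
        using that mem[of \<eta>] \<open>\<gamma>' \<le> \<delta>\<close> \<open>\<delta>' < \<beta>\<close> by (simp add: less_trans[of \<eta> \<delta>'])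
      then show False
        using that \<open>consecutive D \<delta> \<delta>'\<close> \<open>\<not> \<eta> \<le> \<delta>\<close> by (auto simp: consecutive_def)
    qed
    ultimately show ?thesis by (simp add: consecutive_def)
  qed
  moreover have "t \<delta> = Some (c' \<delta>)" if "\<delta> \<in> D" "\<gamma>' \<le> \<delta>" "\<delta> < \<beta>" for \<delta>
    using that mem c climbs_label[OF t] assms(2) by auto
  ultimately show ?thesis
    unfolding climbs_def using climbs_step[OF t] assms(2) order.trans by blast
qed

lemma ex_climb_glueing:
  assumes T: "seq_tree T" and C: "closed_subset {..<\<alpha>} C" and \<gamma>: "\<gamma> \<in> C" "\<gamma> < \<sigma>"
    and cof: "cofinal_in C \<sigma>"
    and climb: "\<And>\<delta>. \<delta> \<in> C \<Longrightarrow> \<gamma> \<le> \<delta> \<Longrightarrow> \<delta> < \<sigma> \<Longrightarrow>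
      \<exists>t\<in>level T \<delta>. t |` {..<\<gamma>} = x \<and> climbs C c F \<gamma> \<delta> t"
  shows "\<exists>t. path T \<sigma> t \<and> t |` {..<\<gamma>} = x \<and> climbs C c F \<gamma> \<sigma> t"
proof -
  obtain G where G: "\<And>\<delta>. \<delta> \<in> C \<Longrightarrow> \<gamma> \<le> \<delta> \<Longrightarrow> \<delta> < \<sigma> \<Longrightarrow>
      G \<delta> \<in> level T \<delta> \<and> G \<delta> |` {..<\<gamma>} = x \<and> climbs C c F \<gamma> \<delta> (G \<delta>)"
    using climb by metis
  have dom: "dom (G \<delta>) = {..<\<delta>}" if "\<delta> \<in> C" "\<gamma> \<le> \<delta>" "\<delta> < \<sigma>" for \<delta>
    using G[OF that] dom_level by blast
  have coh: "G \<delta>' |` {..<\<delta>} = G \<delta>" if "\<delta> \<in> C" "\<gamma> \<le> \<delta>" "\<delta>' \<in> C" "\<delta> \<le> \<delta>'" "\<delta>' < \<sigma>" for \<delta> \<delta>'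
  proof -
    have "\<gamma> \<le> \<delta>'" "\<delta> < \<sigma>" using that by auto
    then have "climbs C c F \<gamma> \<delta> (G \<delta>')" "climbs C c F \<gamma> \<delta> (G \<delta>)"
      and "G \<delta>' |` {..<\<gamma>} = G \<delta> |` {..<\<gamma>}"
      using G[of \<delta>] G[of \<delta>'] that climbs_mono[of C c F \<gamma> \<delta>' "G \<delta>'" \<delta>] by simp_all
    then have "G \<delta>' |` {..<\<delta>} = G \<delta> |` {..<\<delta>}"
      by (rule climbs_unique[OF C \<gamma>(1) _ _ _ that(1,2) order_refl])
    also have "\<dots> = G \<delta>" using that by (intro restrict_map_superset) (simp add: dom)
    finally show ?thesis .
  qed
  have cof': "cofinal_in (C \<inter> {\<gamma>..}) \<sigma>" using cof \<gamma>(2) by (rule cofinal_in_Int_atLeast)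
  obtain t where t: "dom t = {..<\<sigma>}" "\<And>\<delta>. \<delta> \<in> C \<inter> {\<gamma>..} \<Longrightarrow> \<delta> < \<sigma> \<Longrightarrow> t |` {..<\<delta>} = G \<delta>"
    by (rule ex_map_glueing[OF cof', of G]) (use dom coh in auto)
  have "path T \<sigma> t"
    using T cof' t(1) by (rule path_if_cofinal_in) (use t(2) G in \<open>auto simp: level_def\<close>)
  moreover have "climbs C c F \<gamma> \<sigma> t"
    using cof
  proof (rule climbs_limit)
    show "climbs C c F \<gamma> \<delta> t" if "\<delta> \<in> C" "\<gamma> \<le> \<delta>" "\<delta> < \<sigma>" for \<delta>
      using G[OF that] t(2) that climbs_restrict[of C c F \<gamma> \<delta> t] by simp
  qed
  moreover have "t |` {..<\<gamma>} = x"
    using t(2)[of \<gamma>] G[of \<gamma>] dom[of \<gamma>] \<gamma> by (simp add: restrict_map_superset)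
  ultimately show ?thesis by blast
qed

section \<open>Extensions passing through a guessed set\<close>

definition sealing_extension :: "('a \<rightharpoonup> 'b) set \<Rightarrow> ('a \<rightharpoonup> 'b) set \<Rightarrow> ('a \<rightharpoonup> 'b) \<Rightarrow> ('a \<rightharpoonup> 'b)" where
  "sealing_extension X \<Omega> s = (SOME t. t \<in> X \<and> s \<subseteq>\<^sub>m t \<and>
     ((\<exists>u\<in>X. s \<subseteq>\<^sub>m u \<and> (\<exists>d\<in>\<Omega>. d \<subseteq>\<^sub>m u)) \<longrightarrow> (\<exists>d\<in>\<Omega>. d \<subseteq>\<^sub>m t)))"

lemma
  assumes "t \<in> X" "s \<subseteq>\<^sub>m t"
  shows sealing_extension_mem: "sealing_extension X \<Omega> s \<in> X"
    and map_le_sealing_extension: "s \<subseteq>\<^sub>m sealing_extension X \<Omega> s"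
    and sealing_extension_seals: "d \<in> \<Omega> \<Longrightarrow> d \<subseteq>\<^sub>m t \<Longrightarrow> \<exists>d\<in>\<Omega>. d \<subseteq>\<^sub>m sealing_extension X \<Omega> s"
proof -
  have "\<exists>t. t \<in> X \<and> s \<subseteq>\<^sub>m t \<and>
      ((\<exists>u\<in>X. s \<subseteq>\<^sub>m u \<and> (\<exists>d\<in>\<Omega>. d \<subseteq>\<^sub>m u)) \<longrightarrow> (\<exists>d\<in>\<Omega>. d \<subseteq>\<^sub>m t))"
    using assms by blast
  note spec = someI_ex[OF this, folded sealing_extension_def]
  show "sealing_extension X \<Omega> s \<in> X" "s \<subseteq>\<^sub>m sealing_extension X \<Omega> s" using spec by blast+
  show "\<exists>d\<in>\<Omega>. d \<subseteq>\<^sub>m sealing_extension X \<Omega> s" if "d \<in> \<Omega>" "d \<subseteq>\<^sub>m t"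
    using spec assms that by blast
qed

section \<open>Construction of the tree\<close>

locale souslin_construction = regular_uncountable_cardinal ty
  for ty :: "'k::wellorder itself" +
  fixes K :: "'k node set" and \<C> :: "'k \<Rightarrow> 'k set set" and S :: "'k \<Rightarrow> 'k set"
    and code :: "'k node \<Rightarrow> 'k" and level_code :: "'k \<Rightarrow> 'k node \<Rightarrow> 'k"
  assumes streamlined_K: "streamlined_tree K"
    and proxy_\<C>: "proxy_sequence (kappa :: 'k rel) (\<sqsubseteq>\<^sub>*) \<C>"
    and diamond_S: "diamond_sequence S"
    and inj_code: "inj_on code coded_nodes"
    and inj_level_code: "inj_on (level_code \<alpha>) (level K \<alpha>)"
begin

lemma seq_tree_K: "seq_tree K"
  using streamlined_K by (simp add: streamlined_tree_iff)

lemma level_K_nonempty: "level K \<alpha> \<noteq> {}" and level_K_small: "|level K \<alpha>| <o \<kappa>"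
  using streamlined_K by (auto simp: streamlined_tree_iff)

definition label :: "'k node \<Rightarrow> 'k \<Rightarrow> 'k hset" where
  "label \<eta> \<delta> = von_neumann (level_code \<delta> (\<eta> |` {..<\<delta>}))"

text \<open>The two fixed labels make the tree splitting.\<close>

definition labels :: "'k \<Rightarrow> 'k hset set" where
  "labels \<delta> = (\<lambda>\<eta>. label \<eta> \<delta>) ` level K \<delta> \<union> von_neumann ` {ord_zero, osuc ord_zero}"

definition guess :: "'k \<Rightarrow> 'k node set" where
  "guess \<beta> = {d\<in>coded_nodes. code d \<in> S \<beta>}"

function Lev :: "'k \<Rightarrow> 'k node set" where
  "Lev \<alpha> = {t. dom t = {..<\<alpha>} \<and> (\<forall>\<beta>\<in>{..<\<alpha>}. t |` {..<\<beta>} \<in> Lev \<beta> \<and> t \<beta> \<in> Some ` labels \<beta>) \<and>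
     (limit_ord \<alpha> \<longrightarrow> (\<exists>C\<in>\<C> \<alpha>. \<exists>\<eta>\<in>level K \<alpha>. \<exists>\<gamma>\<in>C.
        climbs C (label \<eta>) (\<lambda>\<beta> s. sealing_extension (Lev \<beta>) (guess \<beta>) s) \<gamma> \<alpha> t))}"
  by pat_completeness auto
termination
  by (relation "{(x, y). x < y}") (use proxy_sequence_subset[OF proxy_\<C>] in \<open>auto simp: wf\<close>)

declare Lev.simps [simp del]

definition step :: "'k \<Rightarrow> 'k node \<Rightarrow> 'k node" where
  "step \<beta> s = sealing_extension (Lev \<beta>) (guess \<beta>) s"

lemma Lev_iff:
  "t \<in> Lev \<alpha> \<longleftrightarrow> dom t = {..<\<alpha>} \<and> (\<forall>\<beta><\<alpha>. t |` {..<\<beta>} \<in> Lev \<beta> \<and> t \<beta> \<in> Some ` labels \<beta>) \<and>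
     (limit_ord \<alpha> \<longrightarrow>
       (\<exists>C\<in>\<C> \<alpha>. \<exists>\<eta>\<in>level K \<alpha>. \<exists>\<gamma>\<in>C. climbs C (label \<eta>) step \<gamma> \<alpha> t))"
  unfolding Lev.simps[of \<alpha>] step_def[abs_def] by (simp add: Ball_def)

lemma Lev_dom: "t \<in> Lev \<alpha> \<Longrightarrow> dom t = {..<\<alpha>}"
  by (drule Lev_iff[THEN iffD1]) blast

lemma Lev_label: "t \<in> Lev \<alpha> \<Longrightarrow> \<beta> < \<alpha> \<Longrightarrow> t \<beta> \<in> Some ` labels \<beta>"
  by (drule Lev_iff[THEN iffD1]) blast

lemma Lev_restrict: "t \<in> Lev \<alpha> \<Longrightarrow> \<beta> \<le> \<alpha> \<Longrightarrow> t |` {..<\<beta>} \<in> Lev \<beta>"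
  using Lev_iff[of t \<alpha>] by (cases "\<beta> = \<alpha>") (auto simp: restrict_map_superset)

lemma Lev_coded: "Lev \<alpha> \<subseteq> coded_nodes"
proof
  fix t assume t: "t \<in> Lev \<alpha>"
  have "c \<in> range von_neumann" if c: "c \<in> ran t" for c
  proof -
    obtain \<beta> where \<beta>: "t \<beta> = Some c" using c by (auto simp: ran_def)
    then have "\<beta> < \<alpha>" using Lev_dom[OF t] by auto
    then show ?thesis using Lev_label[OF t] \<beta> by (force simp: labels_def label_def)
  qed
  then show "t \<in> coded_nodes" using Lev_dom[OF t] by (auto simp: coded_nodes_def)
qed

lemma Lev_seqs: "Lev \<alpha> \<subseteq> seqs \<alpha>"
proof
  fix t assume t: "t \<in> Lev \<alpha>"
  have "ran t \<subseteq> range von_neumann" using t Lev_coded[of \<alpha>] by (auto simp: coded_nodes_def)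
  then have "ran t \<subseteq> H_kappa" using von_neumann_H_kappa by blast
  then show "t \<in> seqs \<alpha>" using Lev_dom[OF t] by (simp add: seqs_def)
qed

definition tree :: "'k node set" where
  "tree = (\<Union>\<alpha>. Lev \<alpha>)"

lemma Lev_tree: "t \<in> Lev \<alpha> \<Longrightarrow> t \<in> tree"
  by (auto simp: tree_def)

lemma tree_coded: "tree \<subseteq> coded_nodes"
  using Lev_coded by (auto simp: tree_def)

lemma seq_tree_tree: "seq_tree tree"
  unfolding seq_tree_def
proof (intro conjI ballI allI)
  show "tree \<subseteq> (\<Union>\<alpha>. seqs \<alpha>)" using Lev_seqs by (auto simp: tree_def)
  fix t \<beta> assume "t \<in> tree"
  then obtain \<alpha> where t: "t \<in> Lev \<alpha>" by (auto simp: tree_def)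
  show "t |` {..<\<beta>} \<in> tree"
  proof (cases "\<beta> \<le> \<alpha>")
    case True
    then show ?thesis using Lev_tree[OF Lev_restrict[OF t]] by blast
  next
    case False
    then show ?thesis using Lev_dom[OF t] \<open>t \<in> tree\<close> by (simp add: restrict_map_superset)
  qed
qed

lemma level_tree: "level tree \<alpha> = Lev \<alpha>"
proof
  show "Lev \<alpha> \<subseteq> level tree \<alpha>" using Lev_seqs by (auto simp: level_def tree_def)
  show "level tree \<alpha> \<subseteq> Lev \<alpha>"
  proof
    fix t assume t: "t \<in> level tree \<alpha>"
    then obtain \<beta> where "t \<in> Lev \<beta>" by (auto simp: level_def tree_def)
    moreover from this have "\<beta> = \<alpha>" using Lev_dom dom_level[OF t] by (metis lessThan_eq_iff)
    ultimately show "t \<in> Lev \<alpha>" by simp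
  qed
qed

lemma tree_Lev_ht: "t \<in> tree \<Longrightarrow> t \<in> Lev (ht t)"
  using mem_level_ht[OF seq_tree_tree] level_tree by blast

lemma Lev_ht: "t \<in> Lev \<alpha> \<Longrightarrow> ht t = \<alpha>"
  using ht_level level_tree by blast

lemma Lev_map_le_iff: "s \<in> Lev \<beta> \<Longrightarrow> s \<subseteq>\<^sub>m t \<longleftrightarrow> t |` {..<\<beta>} = s"
  by (simp add: map_le_iff_restrict_map Lev_dom)

lemma path_restrict_Lev: "path tree \<alpha> t \<Longrightarrow> \<beta> < \<alpha> \<Longrightarrow> t |` {..<\<beta>} \<in> Lev \<beta>"
  using path_restrict_level[OF seq_tree_tree] by (simp add: level_tree)

lemma Lev_ord_zero: "Lev ord_zero = {Map.empty}"
  by (auto simp: Lev_iff[of _ ord_zero] limit_ord_def not_less_ord_zero lessThan_ord_zero)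

lemma Lev_osuc: "Lev (osuc \<gamma>) = (\<lambda>(s, c). s(\<gamma> \<mapsto> c)) ` (Lev \<gamma> \<times> labels \<gamma>)"
proof (intro equalityI subsetI)
  fix t assume t: "t \<in> Lev (osuc \<gamma>)"
  obtain c where c: "c \<in> labels \<gamma>" "t \<gamma> = Some c" using Lev_label[OF t less_osuc] by blast
  have "t |` {..<\<gamma>} \<in> Lev \<gamma>" using Lev_restrict[OF t] less_osuc less_imp_le by blast
  moreover have "t = (t |` {..<\<gamma>})(\<gamma> \<mapsto> c)"
  proof
    fix y
    have "t y = None" if "\<gamma> < y"
      using that Lev_dom[OF t] by (metis atMost_iff domIff leD lessThan_osuc)
    then show "t y = ((t |` {..<\<gamma>})(\<gamma> \<mapsto> c)) y"
      using c(2) by (cases y \<gamma> rule: linorder_cases) auto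
  qed
  ultimately show "t \<in> (\<lambda>(s, c). s(\<gamma> \<mapsto> c)) ` (Lev \<gamma> \<times> labels \<gamma>)"
    using c(1) by (auto intro: rev_image_eqI)
next
  fix t assume "t \<in> (\<lambda>(s, c). s(\<gamma> \<mapsto> c)) ` (Lev \<gamma> \<times> labels \<gamma>)"
  then obtain s c where s: "s \<in> Lev \<gamma>" and c: "c \<in> labels \<gamma>" and t: "t = s(\<gamma> \<mapsto> c)" by auto
  have "t |` {..<\<beta>} \<in> Lev \<beta> \<and> t \<beta> \<in> Some ` labels \<beta>" if "\<beta> \<le> \<gamma>" for \<beta>
  proof
    have "t |` {..<\<beta>} = s |` {..<\<beta>}" using leD[OF that] by (simp add: t)
    then show "t |` {..<\<beta>} \<in> Lev \<beta>" using Lev_restrict[OF s that] by simp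
    show "t \<beta> \<in> Some ` labels \<beta>"
      using that c Lev_label[OF s, of \<beta>] by (cases "\<beta> = \<gamma>") (simp_all add: t)
  qed
  moreover have "dom t = {..<osuc \<gamma>}" using Lev_dom[OF s] by (auto simp: t less_osuc_iff)
  ultimately show "t \<in> Lev (osuc \<gamma>)"
    by (subst Lev_iff) (simp add: less_osuc_iff not_limit_ord_osuc)
qed

lemma Lev_limit_iff:
  assumes "limit_ord \<alpha>"
  shows "t \<in> Lev \<alpha> \<longleftrightarrow>
    path tree \<alpha> t \<and> (\<exists>C\<in>\<C> \<alpha>. \<exists>\<eta>\<in>level K \<alpha>. \<exists>\<gamma>\<in>C. climbs C (label \<eta>) step \<gamma> \<alpha> t)"
    (is "_ \<longleftrightarrow> _ \<and> ?climbs")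
proof
  assume "t \<in> Lev \<alpha>"
  then show "path tree \<alpha> t \<and> ?climbs"
    using Lev_iff[of t \<alpha>] assms Lev_tree by (auto simp: path_def)
next
  assume t: "path tree \<alpha> t \<and> ?climbs"
  have "t \<beta> \<in> Some ` labels \<beta>" if "\<beta> < \<alpha>" for \<beta>
  proof -
    have "t |` {..<osuc \<beta>} \<in> Lev (osuc \<beta>)"
      using path_restrict_Lev t osuc_less_limit[OF assms that] by blast
    then show ?thesis using Lev_label[OF _ less_osuc] less_osuc by fastforce
  qed
  then show "t \<in> Lev \<alpha>"
    using t path_restrict_Lev by (subst Lev_iff) (auto simp: path_def)
qed

section \<open>Existence of climbs\<close>

definition extendible_below :: "'k \<Rightarrow> bool" where
  "extendible_below \<alpha> \<longleftrightarrow> (\<forall>\<beta><\<alpha>. \<forall>\<gamma>\<le>\<beta>. \<forall>s\<in>Lev \<gamma>. \<exists>t\<in>Lev \<beta>. s \<subseteq>\<^sub>m t)"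

lemma label_in_labels: "path K \<alpha> \<eta> \<Longrightarrow> \<delta> < \<alpha> \<Longrightarrow> label \<eta> \<delta> \<in> labels \<delta>"
  using path_restrict_level[OF seq_tree_K, of \<alpha> \<eta> \<delta>]
  by (force simp: labels_def label_def intro: rev_image_eqI)

lemma climb_consecutive:
  assumes ext: "extendible_below \<alpha>" and \<eta>: "path K \<alpha> \<eta>"
    and con: "consecutive C \<delta> \<delta>'" and "\<delta>' < \<alpha>"
    and s: "s \<in> Lev \<delta>" "climbs C (label \<eta>) step \<gamma> \<delta> s"
  shows "\<exists>t\<in>Lev \<delta>'. t |` {..<\<delta>} = s \<and> climbs C (label \<eta>) step \<gamma> \<delta>' t"
proof -
  have "\<delta> < \<delta>'" using con by (simp add: consecutive_def)
  define z where "z = s(\<delta> \<mapsto> label \<eta> \<delta>)"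
  define t where "t = step \<delta>' z"
  have "label \<eta> \<delta> \<in> labels \<delta>" using \<eta> less_trans[OF \<open>\<delta> < \<delta>'\<close> \<open>\<delta>' < \<alpha>\<close>] by (rule label_in_labels)
  then have z: "z \<in> Lev (osuc \<delta>)" using s(1) by (auto simp: Lev_osuc z_def)
  then obtain u where "u \<in> Lev \<delta>'" "z \<subseteq>\<^sub>m u"
    using ext osuc_le[OF \<open>\<delta> < \<delta>'\<close>] \<open>\<delta>' < \<alpha>\<close> unfolding extendible_below_def by blast
  then have t: "t \<in> Lev \<delta>'" "z \<subseteq>\<^sub>m t"
    unfolding t_def step_def by (rule sealing_extension_mem, rule map_le_sealing_extension)
  have tz: "t |` {..\<delta>} = z" using t(2) Lev_map_le_iff[OF z] by (simp add: lessThan_osuc)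
  have "{..\<delta>} \<inter> {..<\<delta>} = {..<\<delta>}" by auto
  then have "t |` {..<\<delta>} = (t |` {..\<delta>}) |` {..<\<delta>}" by simp
  also have "\<dots> = s |` {..<\<delta>}" unfolding tz z_def by (simp add: restrict_map_eq_iff)
  also have "\<dots> = s" using Lev_dom[OF s(1)] by (simp add: restrict_map_superset)
  finally have ts: "t |` {..<\<delta>} = s" .
  have "climbs C (label \<eta>) step \<gamma> \<delta>' t"
  proof (rule climbs_consecutive[OF _ con])
    show "climbs C (label \<eta>) step \<gamma> \<delta> t" using s(2) ts climbs_restrict by metis
    show "t \<delta> = Some (label \<eta> \<delta>)" using fun_cong[OF tz, of \<delta>] by (simp add: z_def)
    show "t |` {..<\<delta>'} = step \<delta>' (t |` {..\<delta>})"
      unfolding tz using Lev_dom[OF t(1)] by (simp add: restrict_map_superset flip: t_def)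
  qed
  then show ?thesis using t(1) ts by blast
qed

text \<open>By coherence, a climb along \<open>C\<close> is eventually a climb along some \<open>D \<in> \<C> \<beta>\<close>.\<close>

lemma climb_acc_pt:
  assumes C: "C \<in> \<C> \<alpha>" and \<eta>: "path K \<alpha> \<eta>" and \<beta>: "\<beta> \<in> acc_pts C" "\<gamma> < \<beta>"
    and t: "path tree \<beta> t" "climbs C (label \<eta>) step \<gamma> \<beta> t"
  shows "t \<in> Lev \<beta>"
proof -
  obtain D \<epsilon> where D: "D \<in> \<C> \<beta>" "\<epsilon> < \<beta>" "D \<inter> {\<epsilon>..} = C \<inter> {\<epsilon>..<\<beta>}"
    using proxy_sequence_eventually_coherent[OF proxy_\<C> C \<beta>(1)] by blast
  note limit = acc_pts_limit_ord[OF \<beta>(1)]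
  have "max \<gamma> \<epsilon> < \<beta>" using \<beta>(2) D(2) by simp
  then obtain \<gamma>' where \<gamma>': "\<gamma>' \<in> D" "max \<gamma> \<epsilon> < \<gamma>'"
    using cofinal_inD[OF proxy_sequence_cofinal_in[OF proxy_\<C> D(1) limit]] by blast
  have "climbs D (label (\<eta> |` {..<\<beta>})) step \<gamma>' \<beta> t"
  proof (rule climbs_eventually_eq[OF t(2)])
    show "\<gamma> \<le> \<gamma>'" using \<gamma>'(2) by (simp add: less_imp_le)
    have "D \<inter> {\<gamma>'..} = (D \<inter> {\<epsilon>..}) \<inter> {\<gamma>'..}" using \<gamma>'(2) by auto
    also have "\<dots> = C \<inter> {\<gamma>'..<\<beta>}" unfolding D(3) using \<gamma>'(2) by auto
    finally show "D \<inter> {\<gamma>'..} = C \<inter> {\<gamma>'..<\<beta>}" .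
    show "label (\<eta> |` {..<\<beta>}) \<delta> = label \<eta> \<delta>" if "\<delta> < \<beta>" for \<delta>
      using that by (simp add: label_def Int_absorb1)
  qed
  moreover have "\<beta> < \<alpha>" using \<beta>(1) proxy_sequence_subset[OF proxy_\<C> C] by (auto simp: acc_pts_iff)
  then have "\<eta> |` {..<\<beta>} \<in> level K \<beta>" using path_restrict_level[OF seq_tree_K \<eta>] by blast
  ultimately show ?thesis using Lev_limit_iff[OF limit] t(1) D(1) \<gamma>'(1) by blast
qed

lemma climb_reaches:
  assumes ext: "extendible_below \<alpha>" and C: "C \<in> \<C> \<alpha>" and \<eta>: "path K \<alpha> \<eta>"
    and \<gamma>: "\<gamma> \<in> C" and x: "x \<in> Lev \<gamma>" and "\<delta> \<in> C" "\<gamma> \<le> \<delta>"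
  shows "\<exists>t\<in>Lev \<delta>. t |` {..<\<gamma>} = x \<and> climbs C (label \<eta>) step \<gamma> \<delta> t"
  using proxy_sequence_closed[OF proxy_\<C> C] \<gamma> assms(6,7)
proof (induction \<delta> rule: closed_subset_induct)
  case base
  have "x |` {..<\<gamma>} = x" using Lev_dom[OF x] by (simp add: restrict_map_superset)
  then show ?case using x climbs_start by blast
next
  case (succ \<delta> \<delta>')
  then obtain s where s: "s \<in> Lev \<delta>" "s |` {..<\<gamma>} = x" "climbs C (label \<eta>) step \<gamma> \<delta> s" by blast
  have "\<delta>' < \<alpha>"
    using succ.hyps(1) proxy_sequence_subset[OF proxy_\<C> C] by (auto simp: consecutive_def)
  with s obtain t where t: "t \<in> Lev \<delta>'" "t |` {..<\<delta>} = s" "climbs C (label \<eta>) step \<gamma> \<delta>' t"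
    using climb_consecutive[OF ext \<eta> succ.hyps(1)] by blast
  have "t |` {..<\<gamma>} = x" using s(2) t(2) restrict_map_lessThan_lessThan[OF succ.hyps(2)] by metis
  then show ?case using t by blast
next
  case (limit \<delta>)
  have "cofinal_in C \<delta>" using limit.hyps(1) by (simp add: acc_pts_iff)
  then obtain t where "path tree \<delta> t" "t |` {..<\<gamma>} = x" "climbs C (label \<eta>) step \<gamma> \<delta> t"
    using ex_climb_glueing[OF seq_tree_tree proxy_sequence_closed[OF proxy_\<C> C] \<gamma> limit.hyps(2)]
      limit.IH unfolding level_tree by blast
  then show ?case using climb_acc_pt[OF C \<eta> limit.hyps] by blast
qed

lemma ex_climb:
  assumes "limit_ord \<alpha>" and ext: "extendible_below \<alpha>" and C: "C \<in> \<C> \<alpha>" and \<eta>: "path K \<alpha> \<eta>"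
    and \<gamma>: "\<gamma> \<in> C" and x: "x \<in> Lev \<gamma>"
  obtains t where "path tree \<alpha> t" "x \<subseteq>\<^sub>m t" "climbs C (label \<eta>) step \<gamma> \<alpha> t"
proof -
  have "\<gamma> < \<alpha>" using proxy_sequence_subset[OF proxy_\<C> C] \<gamma> by auto
  then obtain t where "path tree \<alpha> t" "t |` {..<\<gamma>} = x" "climbs C (label \<eta>) step \<gamma> \<alpha> t"
    using ex_climb_glueing[OF seq_tree_tree proxy_sequence_closed[OF proxy_\<C> C] \<gamma> _
        proxy_sequence_cofinal_in[OF proxy_\<C> C assms(1)]]
      climb_reaches[OF ext C \<eta> \<gamma> x] unfolding level_tree by blast
  then show thesis using that Lev_map_le_iff[OF x] by blast
qed

lemma Lev_extend_limit:
  assumes \<alpha>: "limit_ord \<alpha>" and ext: "extendible_below \<alpha>" and \<beta>: "\<beta> < \<alpha>" and s: "s \<in> Lev \<beta>"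
  shows "\<exists>t\<in>Lev \<alpha>. s \<subseteq>\<^sub>m t"
proof -
  obtain C where C: "C \<in> \<C> \<alpha>" using proxy_sequence_nonempty[OF proxy_\<C>] by blast
  obtain \<eta> where \<eta>: "\<eta> \<in> level K \<alpha>" using level_K_nonempty by blast
  obtain \<gamma> where \<gamma>: "\<gamma> \<in> C" "\<beta> < \<gamma>" "\<gamma> < \<alpha>"
    using cofinal_inD[OF proxy_sequence_cofinal_in[OF proxy_\<C> C \<alpha>] \<beta>] by blast
  obtain x where x: "x \<in> Lev \<gamma>" "s \<subseteq>\<^sub>m x"
    using ext \<gamma> s less_imp_le unfolding extendible_below_def by blast
  obtain t where t: "path tree \<alpha> t" "x \<subseteq>\<^sub>m t" "climbs C (label \<eta>) step \<gamma> \<alpha> t"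
    using ex_climb[OF \<alpha> ext C level_path[OF seq_tree_K \<eta>] \<gamma>(1) x(1)] by blast
  then have "t \<in> Lev \<alpha>" using Lev_limit_iff[OF \<alpha>] C \<eta> \<gamma>(1) by blast
  then show ?thesis using map_le_trans[OF x(2) t(2)] by blast
qed

lemma Lev_extend: "\<beta> \<le> \<alpha> \<Longrightarrow> s \<in> Lev \<beta> \<Longrightarrow> \<exists>t\<in>Lev \<alpha>. s \<subseteq>\<^sub>m t"
proof (induction \<alpha> arbitrary: \<beta> s rule: less_induct)
  case (less \<alpha>)
  show ?case
  proof (cases "\<beta> = \<alpha>")
    case True
    then show ?thesis using less.prems map_le_refl by blast
  next
    case False
    then have "\<beta> < \<alpha>" using less.prems by simp
    show ?thesis
    proof (cases \<alpha> rule: ord_cases)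
      case zero
      then show ?thesis using \<open>\<beta> < \<alpha>\<close> not_less_ord_zero by blast
    next
      case (succ \<gamma>)
      then have "\<beta> \<le> \<gamma>" "\<gamma> < \<alpha>" using \<open>\<beta> < \<alpha>\<close> less_osuc by (auto simp: less_osuc_iff)
      then obtain t where t: "t \<in> Lev \<gamma>" "s \<subseteq>\<^sub>m t" using less.IH less.prems by blast
      have "t(\<gamma> \<mapsto> von_neumann ord_zero) \<in> Lev \<alpha>"
        using t(1) by (auto simp: succ Lev_osuc labels_def)
      moreover have "t \<subseteq>\<^sub>m t(\<gamma> \<mapsto> von_neumann ord_zero)"
        using Lev_dom[OF t(1)] by (auto simp: map_le_def)
      ultimately show ?thesis using t map_le_trans by blast
    next
      case limit
      have "extendible_below \<alpha>" using less.IH by (simp add: extendible_below_def)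
      then show ?thesis using Lev_extend_limit limit \<open>\<beta> < \<alpha>\<close> less.prems(2) by blast
    qed
  qed
qed

lemma extendible_below: "extendible_below \<alpha>"
  using Lev_extend by (simp add: extendible_below_def)

section \<open>Cardinality of the levels\<close>

lemma labels_small: "|labels \<delta>| <o \<kappa>"
  unfolding labels_def by (intro small_Un small_image level_K_small small_finite) simp

definition climb_nodes :: "'k \<Rightarrow> 'k set \<Rightarrow> 'k node \<Rightarrow> 'k \<Rightarrow> 'k node \<Rightarrow> 'k node set" where
  "climb_nodes \<alpha> C \<eta> \<gamma> x =
    {t\<in>Lev \<alpha>. \<gamma> \<in> C \<and> climbs C (label \<eta>) step \<gamma> \<alpha> t \<and> t |` {..<\<gamma>} = x}"

lemma Lev_limit_subset_climb_nodes:
  assumes \<alpha>: "limit_ord \<alpha>"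
  shows "Lev \<alpha> \<subseteq> (\<Union>C\<in>\<C> \<alpha>. \<Union>\<eta>\<in>level K \<alpha>. \<Union>\<gamma>\<in>{..<\<alpha>}. \<Union>x\<in>Lev \<gamma>. climb_nodes \<alpha> C \<eta> \<gamma> x)"
proof
  fix t assume t: "t \<in> Lev \<alpha>"
  then obtain C \<eta> \<gamma>
    where C: "C \<in> \<C> \<alpha>" "\<eta> \<in> level K \<alpha>" "\<gamma> \<in> C" "climbs C (label \<eta>) step \<gamma> \<alpha> t"
    using Lev_limit_iff[OF \<alpha>] by blast
  moreover have "\<gamma> < \<alpha>" using proxy_sequence_subset[OF proxy_\<C> C(1)] C(3) by auto
  moreover from this have "t |` {..<\<gamma>} \<in> Lev \<gamma>" using Lev_restrict[OF t] by simp
  ultimately show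
    "t \<in> (\<Union>C\<in>\<C> \<alpha>. \<Union>\<eta>\<in>level K \<alpha>. \<Union>\<gamma>\<in>{..<\<alpha>}. \<Union>x\<in>Lev \<gamma>. climb_nodes \<alpha> C \<eta> \<gamma> x)"
    using t by (auto simp: climb_nodes_def)
qed

lemma climb_nodes_unique:
  assumes "limit_ord \<alpha>" and C: "C \<in> \<C> \<alpha>"
    and t: "t \<in> climb_nodes \<alpha> C \<eta> \<gamma> x" "t' \<in> climb_nodes \<alpha> C \<eta> \<gamma> x"
  shows "t = t'"
proof (rule climbs_unique_limit)
  show "closed_subset {..<\<alpha>} C" using proxy_\<C> C by (rule proxy_sequence_closed)
  show "cofinal_in C \<alpha>" using proxy_\<C> C assms(1) by (rule proxy_sequence_cofinal_in)
qed (use t Lev_dom in \<open>auto simp: climb_nodes_def\<close>)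

lemma Lev_limit_small:
  assumes \<alpha>: "limit_ord \<alpha>" and small: "\<And>\<gamma>. \<gamma> < \<alpha> \<Longrightarrow> |Lev \<gamma>| <o \<kappa>"
  shows "|Lev \<alpha>| <o \<kappa>"
proof (rule small_mono[OF Lev_limit_subset_climb_nodes[OF \<alpha>]])
  have "|climb_nodes \<alpha> C \<eta> \<gamma> x| <o \<kappa>" if "C \<in> \<C> \<alpha>" for C \<eta> \<gamma> x
  proof -
    have "climb_nodes \<alpha> C \<eta> \<gamma> x = {} \<or> (\<exists>t. climb_nodes \<alpha> C \<eta> \<gamma> x = {t})"
      using climb_nodes_unique[OF \<alpha> that] by blast
    then show ?thesis by (auto intro: small_finite)
  qed
  then show
    "|\<Union>C\<in>\<C> \<alpha>. \<Union>\<eta>\<in>level K \<alpha>. \<Union>\<gamma>\<in>{..<\<alpha>}. \<Union>x\<in>Lev \<gamma>. climb_nodes \<alpha> C \<eta> \<gamma> x| <o \<kappa>"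
    by (intro small_UN proxy_sequence_card[OF proxy_\<C>] level_K_small small_lessThan small) simp_all
qed

lemma Lev_small: "|Lev \<alpha>| <o \<kappa>"
proof (induction \<alpha> rule: less_induct)
  case (less \<alpha>)
  show ?case
  proof (cases \<alpha> rule: ord_cases)
    case zero
    then show ?thesis by (simp add: Lev_ord_zero small_finite)
  next
    case (succ \<gamma>)
    then have "|Lev \<gamma>| <o \<kappa>" using less_osuc by (intro less.IH) simp
    then show ?thesis unfolding succ Lev_osuc by (intro small_image small_Times labels_small)
  next
    case limit
    then show ?thesis using less.IH by (rule Lev_limit_small)
  qed
qed

lemma streamlined_tree_tree: "streamlined_tree tree"
  unfolding streamlined_tree_iff level_tree
  using seq_tree_tree Lev_small Lev_extend[OF ord_zero_le] Lev_ord_zero by fast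

lemma normal_tree_tree: "normal_tree tree"
  unfolding normal_tree_def level_tree
proof (intro allI impI ballI)
  fix \<alpha> \<beta> s assume "\<alpha> < \<beta>" and s: "s \<in> Lev \<alpha>"
  then obtain t where t: "t \<in> Lev \<beta>" "s \<subseteq>\<^sub>m t" using Lev_extend[OF less_imp_le] by blast
  moreover have "s \<noteq> t" using \<open>\<alpha> < \<beta>\<close> Lev_ht[OF s] Lev_ht[OF t(1)] by auto
  ultimately show "\<exists>t\<in>Lev \<beta>. s \<subset>\<^sub>m t" by (auto simp: below_def)
qed

lemma update_in_imm_succs:
  assumes s: "s \<in> Lev \<gamma>" and c: "c \<in> labels \<gamma>"
  shows "s(\<gamma> \<mapsto> c) \<in> imm_succs tree s"
proof -
  have t: "s(\<gamma> \<mapsto> c) \<in> Lev (osuc \<gamma>)" using s c by (auto simp: Lev_osuc)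
  have "s \<gamma> = None" using Lev_dom[OF s] by (metis domIff lessThan_iff less_irrefl)
  then have "s \<subset>\<^sub>m s(\<gamma> \<mapsto> c)" by (auto simp: below_def map_le_def fun_eq_iff)
  moreover have False if u: "u \<in> tree" "s \<subset>\<^sub>m u" "u \<subset>\<^sub>m s(\<gamma> \<mapsto> c)" for u
    using below_ht_less[OF seq_tree_tree Lev_tree[OF s] u(1,2)]
      below_ht_less[OF seq_tree_tree u(1) Lev_tree[OF t] u(3)] Lev_ht[OF s] Lev_ht[OF t]
    by (simp add: less_osuc_iff)
  ultimately show ?thesis using Lev_tree[OF t] by (auto simp: imm_succs_def)
qed

lemma splitting_tree_tree: "splitting_tree tree"
  unfolding splitting_tree_def
proof
  fix s assume "s \<in> tree"
  define t where "t \<alpha> = s(ht s \<mapsto> von_neumann \<alpha>)" for \<alpha>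
  have "t ord_zero \<in> imm_succs tree s" "t (osuc ord_zero) \<in> imm_succs tree s"
    using tree_Lev_ht[OF \<open>s \<in> tree\<close>] unfolding t_def
    by (auto intro!: update_in_imm_succs simp: labels_def)
  moreover have "t ord_zero \<noteq> t (osuc ord_zero)"
    using less_osuc[of ord_zero] inj_von_neumann
    by (metis fun_upd_same injD less_irrefl option.inject t_def)
  ultimately show "\<exists>t\<in>imm_succs tree s. \<exists>u\<in>imm_succs tree s. t \<noteq> u" by blast
qed

section \<open>Sealing dense sets\<close>

definition sealing_point :: "'k node set \<Rightarrow> 'k \<Rightarrow> bool" where
  "sealing_point D \<beta> \<longleftrightarrow> limit_ord \<beta> \<and> guess \<beta> = {d\<in>D. code d < \<beta>} \<and>
     (\<forall>\<delta><\<beta>. \<forall>s\<in>Lev \<delta>. \<exists>d\<in>D. s \<subseteq>\<^sub>m d \<and> ht d < \<beta> \<and> code d < \<beta>)"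

lemma guess_eq:
  assumes "D \<subseteq> coded_nodes" "code ` D \<inter> {..<\<beta>} = S \<beta>"
  shows "guess \<beta> = {d\<in>D. code d < \<beta>}"
proof -
  have "code d \<in> S \<beta> \<longleftrightarrow> d \<in> D \<and> code d < \<beta>" if "d \<in> coded_nodes" for d
    using inj_on_image_mem_iff[OF inj_code that assms(1)] assms(2)[symmetric] by simp
  then show ?thesis using assms(1) by (auto simp: guess_def)
qed

lemma dense_in_extension_bound:
  assumes D: "dense_in tree D"
  shows "\<exists>\<xi>. \<forall>s\<in>Lev \<delta>. \<exists>d\<in>D. s \<subseteq>\<^sub>m d \<and> ht d < \<xi> \<and> code d < \<xi>"
proof -
  obtain h where h: "\<And>s. s \<in> Lev \<delta> \<Longrightarrow> h s \<in> D \<and> s \<subseteq>\<^sub>m h s"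
    using D Lev_tree unfolding dense_in_def by metis
  have "|(ht \<circ> h) ` Lev \<delta> \<union> (code \<circ> h) ` Lev \<delta>| <o \<kappa>" by (intro small_Un small_image Lev_small)
  then obtain \<xi> where "(ht \<circ> h) ` Lev \<delta> \<union> (code \<circ> h) ` Lev \<delta> \<subseteq> {..<\<xi>}" by (rule small_bounded)
  then show ?thesis using h by (intro exI[of _ \<xi>]) fastforce
qed

lemma cofinal_sealing_points:
  assumes D: "dense_in tree D"
  shows "cofinal_kappa {\<beta>. sealing_point D \<beta>}"
  unfolding cofinal_kappa_def
proof
  fix \<alpha>
  obtain f where f: "\<And>\<delta> s. s \<in> Lev \<delta> \<Longrightarrow> \<exists>d\<in>D. s \<subseteq>\<^sub>m d \<and> ht d < f \<delta> \<and> code d < f \<delta>"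
    using dense_in_extension_bound[OF D] by metis
  obtain \<beta> where \<beta>: "code ` D \<inter> {..<\<beta>} = S \<beta>" "\<alpha> < \<beta>" "limit_ord \<beta>" "\<And>\<delta>. \<delta> < \<beta> \<Longrightarrow> f \<delta> < \<beta>"
    by (rule diamond_sequence_closure_point[OF diamond_S, of "code ` D" \<alpha> f]) blast
  have "D \<subseteq> coded_nodes" using D tree_coded by (auto simp: dense_in_def)
  then have "guess \<beta> = {d\<in>D. code d < \<beta>}" using \<beta>(1) by (rule guess_eq)
  then have "sealing_point D \<beta>"
    unfolding sealing_point_def using \<beta>(3,4) f less_trans by meson
  then show "\<exists>\<beta>\<in>{\<beta>. sealing_point D \<beta>}. \<alpha> \<le> \<beta>" using \<beta>(2) by auto
qed

lemma step_seals:
  assumes "D \<subseteq> tree" and \<beta>: "sealing_point D \<beta>" and "\<delta> < \<beta>" "s \<in> Lev \<delta>"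
  shows "\<exists>d\<in>D. d \<subseteq>\<^sub>m step \<beta> s"
proof -
  obtain d where d: "d \<in> D" "s \<subseteq>\<^sub>m d" "ht d < \<beta>" "code d < \<beta>"
    using \<beta> assms(3,4) unfolding sealing_point_def by blast
  obtain t where t: "t \<in> Lev \<beta>" "d \<subseteq>\<^sub>m t"
    using Lev_extend[OF less_imp_le[OF d(3)] tree_Lev_ht] d(1) assms(1) by blast
  have guess: "guess \<beta> = {d\<in>D. code d < \<beta>}" using \<beta> by (simp add: sealing_point_def)
  have "\<exists>d\<in>guess \<beta>. d \<subseteq>\<^sub>m step \<beta> s"
    unfolding step_def
    by (rule sealing_extension_seals[OF t(1) map_le_trans[OF d(2) t(2)] _ t(2)])
      (use d guess in simp)
  then show ?thesis using guess by blast
qed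

lemma dense_in_sealed:
  assumes D: "dense_in tree D"
  shows "\<exists>\<alpha>. sealed_at tree D \<alpha>"
proof -
  define B where "B = {\<beta>. sealing_point D \<beta>}"
  have "stationary {\<alpha>. \<forall>C\<in>\<C> \<alpha>. cofinal_in (nacc_pts C \<inter> B) \<alpha>}"
    unfolding B_def using cofinal_sealing_points[OF D] by (rule proxy_sequence_hitting[OF proxy_\<C>])
  then obtain \<alpha> where \<alpha>: "limit_ord \<alpha>" "\<forall>C\<in>\<C> \<alpha>. cofinal_in (nacc_pts C \<inter> B) \<alpha>"
    by (rule stationary_closure_point[where f = id]) blast
  have "\<exists>d\<in>D. d \<subseteq>\<^sub>m t" if t: "t \<in> Lev \<alpha>" for t
  proof -
    obtain C \<eta> \<gamma> where C: "C \<in> \<C> \<alpha>" and \<gamma>: "\<gamma> \<in> C" and climb: "climbs C (label \<eta>) step \<gamma> \<alpha> t"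
      using t Lev_limit_iff[OF \<alpha>(1)] by blast
    have "\<gamma> < \<alpha>" using proxy_sequence_subset[OF proxy_\<C> C] \<gamma> by auto
    then obtain \<beta> where \<beta>: "\<beta> \<in> nacc_pts C" "sealing_point D \<beta>" "\<gamma> < \<beta>" "\<beta> < \<alpha>"
      using \<alpha>(2) C cofinal_inD[of "nacc_pts C \<inter> B" \<alpha> \<gamma>] by (auto simp: B_def)
    obtain \<delta> where \<delta>: "\<gamma> \<le> \<delta>" "consecutive C \<delta> \<beta>"
      using nacc_pts_predecessor[OF proxy_sequence_closed[OF proxy_\<C> C] \<beta>(1) \<gamma> \<beta>(3)] by blast
    have "osuc \<delta> < \<beta>"
      using \<delta>(2) \<beta>(2) osuc_less_limit by (simp add: sealing_point_def consecutive_def)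
    moreover from this have "t |` {..\<delta>} \<in> Lev (osuc \<delta>)"
      using Lev_restrict[OF t, of "osuc \<delta>"] \<beta>(4) by (simp add: lessThan_osuc)
    ultimately have "\<exists>d\<in>D. d \<subseteq>\<^sub>m step \<beta> (t |` {..\<delta>})"
      using step_seals[OF _ \<beta>(2)] D by (simp add: dense_in_def)
    then have "\<exists>d\<in>D. d \<subseteq>\<^sub>m t |` {..<\<beta>}"
      using climbs_step[OF climb \<delta>(2,1)] \<beta>(4) by simp
    then show ?thesis using map_le_trans restrict_map_le by blast
  qed
  then show ?thesis unfolding sealed_at_def level_tree by blast
qed

lemma souslin_tree_tree: "souslin_tree tree"
  using streamlined_tree_tree splitting_tree_tree dense_in_sealed by (rule souslin_tree_if_sealed)

section \<open>Vanishing levels\<close>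

lemma label_inject:
  assumes "path K \<alpha> \<eta>" "path K \<alpha> \<xi>" "\<delta> < \<alpha>" "label \<eta> \<delta> = label \<xi> \<delta>"
  shows "\<eta> |` {..<\<delta>} = \<xi> |` {..<\<delta>}"
proof -
  have "level_code \<delta> (\<eta> |` {..<\<delta>}) = level_code \<delta> (\<xi> |` {..<\<delta>})"
    using assms(4) unfolding label_def by (rule injD[OF inj_von_neumann])
  then show ?thesis
    using inj_onD[OF inj_level_code] path_restrict_level[OF seq_tree_K] assms(1-3) by blast
qed

lemma climb_determines_path:
  assumes \<alpha>: "limit_ord \<alpha>" "meets_cofinally \<C> \<alpha>" and CD: "C \<in> \<C> \<alpha>" "D \<in> \<C> \<alpha>"
    and \<gamma>: "\<gamma> \<in> C" "\<gamma>' \<in> D" and paths: "path K \<alpha> \<eta>" "path K \<alpha> \<xi>"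
    and t: "climbs C (label \<eta>) step \<gamma> \<alpha> t" "climbs D (label \<xi>) step \<gamma>' \<alpha> t"
  shows "\<eta> = \<xi>"
proof -
  have "max \<gamma> \<gamma>' < \<alpha>" using \<gamma> CD proxy_sequence_subset[OF proxy_\<C>] by auto
  then have "cofinal_in (C \<inter> D \<inter> {max \<gamma> \<gamma>'..}) \<alpha>"
    using \<alpha>(2) CD by (intro cofinal_in_Int_atLeast) (auto simp: meets_cofinally_def)
  then have "\<eta> |` {..<\<alpha>} = \<xi> |` {..<\<alpha>}"
  proof (rule restrict_eq_if_cofinal_in)
    fix \<delta> assume \<delta>: "\<delta> \<in> C \<inter> D \<inter> {max \<gamma> \<gamma>'..}" "\<delta> < \<alpha>"
    then have "Some (label \<eta> \<delta>) = Some (label \<xi> \<delta>)"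
      using climbs_label[OF t(1), of \<delta>] climbs_label[OF t(2), of \<delta>] by simp
    then show "\<eta> |` {..<\<delta>} = \<xi> |` {..<\<delta>}" using label_inject[OF paths \<delta>(2)] by simp
  qed
  then show ?thesis using paths by (simp add: path_def restrict_map_superset)
qed

lemma V_minus_subset_V_full:
  assumes \<alpha>: "\<alpha> \<in> V_minus K" and meets: "meets_cofinally \<C> \<alpha>"
  shows "\<alpha> \<in> V_full tree"
proof -
  obtain \<eta> where limit: "limit_ord \<alpha>" and \<eta>: "path K \<alpha> \<eta>" "\<eta> \<notin> K"
    using \<alpha> V_minus_iff[OF seq_tree_K] by blast
  have "\<exists>t. path tree \<alpha> t \<and> t \<notin> tree \<and> s \<subseteq>\<^sub>m t" if s: "s \<in> tree" "ht s < \<alpha>" for s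
  proof -
    obtain C where C: "C \<in> \<C> \<alpha>" using proxy_sequence_nonempty[OF proxy_\<C>] by blast
    obtain \<gamma> where \<gamma>: "\<gamma> \<in> C" "ht s < \<gamma>"
      using cofinal_inD[OF proxy_sequence_cofinal_in[OF proxy_\<C> C limit] s(2)] by blast
    obtain x where x: "x \<in> Lev \<gamma>" "s \<subseteq>\<^sub>m x"
      using Lev_extend[OF less_imp_le[OF \<gamma>(2)] tree_Lev_ht[OF s(1)]] by blast
    obtain t where t: "path tree \<alpha> t" "x \<subseteq>\<^sub>m t" "climbs C (label \<eta>) step \<gamma> \<alpha> t"
      using ex_climb[OF limit extendible_below C \<eta>(1) \<gamma>(1) x(1)] by blast
    have "t \<notin> tree"
    proof
      assume "t \<in> tree"
      then have "t \<in> Lev \<alpha>"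
        using t(1) mem_level_iff[OF seq_tree_tree] level_tree by (auto simp: path_def)
      then obtain D \<xi> \<gamma>' where D: "D \<in> \<C> \<alpha>" "\<gamma>' \<in> D" "climbs D (label \<xi>) step \<gamma>' \<alpha> t"
        and \<xi>: "\<xi> \<in> level K \<alpha>"
        using Lev_limit_iff[OF limit] by blast
      have "\<eta> = \<xi>"
        using climb_determines_path[OF limit meets C D(1) \<gamma>(1) D(2) \<eta>(1)
            level_path[OF seq_tree_K \<xi>] t(3) D(3)] .
      then show False using \<eta>(2) \<xi> by (simp add: level_def)
    qed
    then show ?thesis using t(1) map_le_trans[OF x(2) t(2)] by blast
  qed
  then show ?thesis using V_full_iff[OF seq_tree_tree] limit by blast
qed

end

lemma (in regular_uncountable_cardinal) ex_souslin_tree: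
  fixes K :: "'k node set" and \<C> :: "'k \<Rightarrow> 'k set set"
  assumes K: "streamlined_tree K" and "diamond TYPE('k)"
    and \<C>: "proxy_sequence \<kappa> (\<sqsubseteq>\<^sub>*) \<C>"
    and meets: "\<And>\<alpha>. limit_ord \<alpha> \<Longrightarrow> \<alpha> \<in> A \<Longrightarrow> meets_cofinally \<C> \<alpha>"
  shows "\<exists>T :: 'k node set. normal_tree T \<and> splitting_tree T \<and> souslin_tree T \<and>
    V_minus K \<inter> A \<subseteq> V_full T"
proof -
  obtain S :: "'k \<Rightarrow> 'k set" where S: "diamond_sequence S"
    using diamond_imp_ex_diamond_sequence[OF assms(2)] ..
  obtain code :: "'k node \<Rightarrow> 'k" where code: "inj_on code coded_nodes"
    using diamond_enumerates_coded_nodes[OF S] by blast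
  have "\<exists>f :: 'k node \<Rightarrow> 'k. inj_on f (level K \<alpha>)" for \<alpha>
    using K small_ordLeq_UNIV card_of_ordLeq[of "level K \<alpha>" "UNIV :: 'k set"]
    by (auto simp: streamlined_tree_iff)
  then obtain level_code :: "'k \<Rightarrow> 'k node \<Rightarrow> 'k"
    where level_code: "\<And>\<alpha>. inj_on (level_code \<alpha>) (level K \<alpha>)" by metis
  interpret souslin_construction ty K \<C> S code level_code
    by unfold_locales (fact K \<C> S code level_code)+
  have "limit_ord \<alpha>" if "\<alpha> \<in> V_minus K" for \<alpha> using that by (simp add: V_minus_def)
  then have "V_minus K \<inter> A \<subseteq> V_full tree" using meets V_minus_subset_V_full by blast
  then show ?thesis using normal_tree_tree splitting_tree_tree souslin_tree_tree by blast
qed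

theorem theorem3p7:
  fixes K :: "'k::wellorder node set"
  assumes "Card_order (kappa :: 'k rel)"
    and "regularCard (kappa :: 'k rel)"
    and "natLeq <o (kappa :: 'k rel)"
    and "streamlined_tree K"
  shows "(proxy_P ctwo (init_seg_star :: 'k set \<Rightarrow> 'k set \<Rightarrow> bool) \<longrightarrow>
           (\<exists>T :: 'k node set. normal_tree T \<and> splitting_tree T \<and> souslin_tree T \<and>
              V_minus K \<subseteq> V_full T)) \<and>
         (proxy_P (kappa :: 'k rel) (init_seg :: 'k set \<Rightarrow> 'k set \<Rightarrow> bool) \<longrightarrow>
           (\<exists>T :: 'k node set. normal_tree T \<and> splitting_tree T \<and> souslin_tree T \<and>
              V_minus K \<inter> E_gt_omega \<subseteq> V_full T))"
proof -
  interpret regular_uncountable_cardinal "TYPE('k)"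
    using assms(1-3) ordLess_imp_ordLeq by unfold_locales
  show ?thesis
  proof (intro conjI impI, goal_cases)
    case 1
    then obtain \<C> :: "'k \<Rightarrow> 'k set set"
      where diamond: "diamond TYPE('k)" and \<C>: "proxy_sequence ctwo (\<sqsubseteq>\<^sub>*) \<C>"
      by (auto simp: proxy_P_iff)
    have "proxy_sequence \<kappa> (\<sqsubseteq>\<^sub>*) \<C>"
      using \<C> ctwo_ordLeq_Cinfinite[OF Cinfinite_kappa] by (rule proxy_sequence_mono)
    from ex_souslin_tree[OF assms(4) diamond this, of UNIV] show ?case
      using meets_cofinally_ctwo[OF \<C>] by simp
  next
    case 2
    then obtain \<C> :: "'k \<Rightarrow> 'k set set"
      where diamond: "diamond TYPE('k)" and \<C>: "proxy_sequence \<kappa> (\<sqsubseteq>\<^sub>i) \<C>"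
      by (auto simp: proxy_P_iff)
    have "proxy_sequence \<kappa> (\<sqsubseteq>\<^sub>*) \<C>" using \<C> by (rule proxy_sequence_init_seg_star)
    with assms(4) diamond show ?case
      using meets_cofinally_E_gt_omega[OF \<C>] by (rule ex_souslin_tree)
  qed
qed

end
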